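(* Let $\Bbbk$ be a field of characteristic different from $2$, let $n\ge 1$ be an integer, and let $\mathcal{E}=\bigwedge_{\Bbbk}(e_1,\dots,e_n)$ be the Grassmann $\Bbbk$-algebra on $n$ generators with its standard grading $\mathcal{E}=\bigoplus_{i=0}^{n}\mathcal{E}_i$. A nonzero $\Bbbk$-subspace $B\subseteq\mathcal{E}$ is $\mathrm{Aut}$-stable if and only if $B$ has one of the following forms: (a) for some even integer $j$ with $0<j\le n$, $$B=\bigoplus_{\substack{j\le k\le n\\ k\ \text{even}}}\mathcal{E}_k;$$ (b) for some integer $j$ with $1\le j\le n$, $$B=\bigoplus_{j\le i\le n}\mathcal{E}_i;$$ (c) $B=B_1+B_2$, where $B_1$ is of the form in (a) and $B_2$ is of the form in (b); (d) $B=\Bbbk+B'$, where $B'=0$ or $B'$ is of the form in (a), (b) or (c).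
   Context: All algebras are associative with unity. The Grassmann algebra $\mathcal{E}=\bigwedge_{\Bbbk}(e_1,\dots,e_n)$ is the unital associative $\Bbbk$-algebra generated by $e_1,\dots,e_n$ with relations $e_i\wedge e_j=-e_j\wedge e_i$ for all $1\le i,j\le n$ (so in particular $e_i\wedge e_i=0$). Its standard grading is $\mathcal{E}=\bigoplus_{i=0}^n\mathcal{E}_i$, where $\mathcal{E}_0=\Bbbk$ and, for $1\le i\le n$, $\mathcal{E}_i$ is the $\Bbbk$-span of all products $e_{j_1}\wedge\cdots\wedge e_{j_i}$ with $1\le j_1<\cdots<j_i\le n$. A $\Bbbk$-subspace $V$ of a $\Bbbk$-algebra $A$ is called $\mathrm{Aut}$-stable if $\sigma(V)\subseteq V$ for every $\Bbbk$-algebra automorphism $\sigma$ of $A$ (a bijective, $\Bbbk$-linear ring homomorphism $A\to A$). Automorphisms are not required to preserve the grading. *)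

theory Defs
  imports
    Complex_Main
    "HOL-Library.Poly_Mapping"
    "HOL-Library.Set_Algebras"
    "HOL-Library.Numeral_Type"
    "HOL-Computational_Algebra.Computational_Algebra"
begin

section \<open>The free associative algebra\<close>

text \<open>
  Words in the letters \<open>'x\<close> under concatenation, written additively because the convolution
  product on \<open>poly_mapping\<close> is indexed by an additive monoid. Hence \<open>'x word \<Rightarrow>\<^sub>0 'k\<close> is the free
  unital associative \<open>'k\<close>-algebra on \<open>'x\<close>. The wrapper avoids a global instance for lists.
\<close>

datatype 'x word = Word (letters: "'x list")

instantiation word :: (type) monoid_add
begin
definition "0 = Word []"
definition "u + v = Word (letters u @ letters v)"
instance
  by standard (simp_all add: zero_word_def plus_word_def)
end

definition free_gen :: "'x \<Rightarrow> ('x word \<Rightarrow>\<^sub>0 'k::comm_ring_1)" where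
  "free_gen i = Poly_Mapping.single (Word [i]) 1"

definition free_scale :: "'k::comm_ring_1 \<Rightarrow> ('x word \<Rightarrow>\<^sub>0 'k) \<Rightarrow> ('x word \<Rightarrow>\<^sub>0 'k)" where
  "free_scale c p = Poly_Mapping.single 0 c * p"

lemma lookup_free_scale: "Poly_Mapping.lookup (free_scale c p) w = c * Poly_Mapping.lookup p w"
proof -
  have "free_scale c p = Poly_Mapping.map ((*) c) p"
    by (simp add: free_scale_def mult_map_scale_conv_mult)
  then show ?thesis by (simp add: Poly_Mapping.map.rep_eq when_def)
qed

lemma free_scale_commutes: "p * Poly_Mapping.single 0 c = free_scale c p"
proof (rule poly_mapping_eqI)
  fix w :: "'a word"
  have eq: "Sum_any (\<lambda>q. Poly_Mapping.lookup (Poly_Mapping.single 0 c) q when w = l + q) = (c when l = w)"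
    for l :: "'a word"
  proof -
    have "(\<lambda>q. Poly_Mapping.lookup (Poly_Mapping.single 0 c) q when w = l + q)
        = (\<lambda>q. (c when l = w) when q = 0)"
      by (rule ext) (auto simp: when_def lookup_single)
    then show ?thesis by (simp only: Sum_any_when_equal)
  qed
  have "Poly_Mapping.lookup (p * Poly_Mapping.single 0 c) w
      = Sum_any (\<lambda>l. Poly_Mapping.lookup p l * c when l = w)"
    by (simp only: lookup_mult eq mult_when)
  also have "\<dots> = Poly_Mapping.lookup p w * c"
    by (simp only: Sum_any_when_equal)
  finally show "Poly_Mapping.lookup (p * Poly_Mapping.single 0 c) w
      = Poly_Mapping.lookup (free_scale c p) w"
    by (simp only: lookup_free_scale mult.commute)
qed


section \<open>Two-sided ideals\<close>

definition two_sided_ideal :: "'a::ring_1 set \<Rightarrow> bool" where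
  "two_sided_ideal I \<longleftrightarrow>
     0 \<in> I \<and> (\<forall>x\<in>I. \<forall>y\<in>I. x + y \<in> I) \<and> (\<forall>x\<in>I. \<forall>r. r * x \<in> I \<and> x * r \<in> I)"

lemma two_sided_ideal_hull: "two_sided_ideal (two_sided_ideal hull S)"
  by (rule hull_in) (auto simp: two_sided_ideal_def)

lemma two_sided_ideal_uminus: "two_sided_ideal I \<Longrightarrow> x \<in> I \<Longrightarrow> - x \<in> I"
  unfolding two_sided_ideal_def by (metis mult_minus1)

lemma two_sided_ideal_diff: "two_sided_ideal I \<Longrightarrow> x \<in> I \<Longrightarrow> y \<in> I \<Longrightarrow> x - y \<in> I"
  using two_sided_ideal_uminus[of I y] unfolding two_sided_ideal_def
  by (metis add_uminus_conv_diff)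


section \<open>The Grassmann algebra\<close>

definition grassmann_relations :: "('n word \<Rightarrow>\<^sub>0 'k::comm_ring_1) set" where
  "grassmann_relations =
     {free_gen i * free_gen j - (- (free_gen j * free_gen i)) | i j. True}"

definition grassmann_ideal :: "('n word \<Rightarrow>\<^sub>0 'k::comm_ring_1) set" where
  "grassmann_ideal = two_sided_ideal hull grassmann_relations"

definition grassmann_rel ::
    "('n word \<Rightarrow>\<^sub>0 'k::comm_ring_1) \<Rightarrow> ('n word \<Rightarrow>\<^sub>0 'k) \<Rightarrow> bool" where
  "grassmann_rel p q \<longleftrightarrow> p - q \<in> grassmann_ideal"

lemma two_sided_ideal_grassmann: "two_sided_ideal grassmann_ideal"
  unfolding grassmann_ideal_def by (rule two_sided_ideal_hull)

lemma grassmann_ideal_add: "p \<in> grassmann_ideal \<Longrightarrow> q \<in> grassmann_ideal \<Longrightarrow> p + q \<in> grassmann_ideal"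
  and grassmann_ideal_mult_left: "p \<in> grassmann_ideal \<Longrightarrow> r * p \<in> grassmann_ideal"
  and grassmann_ideal_mult_right: "p \<in> grassmann_ideal \<Longrightarrow> p * r \<in> grassmann_ideal"
  and grassmann_ideal_zero: "0 \<in> grassmann_ideal"
  and grassmann_ideal_uminus: "p \<in> grassmann_ideal \<Longrightarrow> - p \<in> grassmann_ideal"
  and grassmann_ideal_diff: "p \<in> grassmann_ideal \<Longrightarrow> q \<in> grassmann_ideal \<Longrightarrow> p - q \<in> grassmann_ideal"
  using two_sided_ideal_grassmann two_sided_ideal_uminus two_sided_ideal_diff
  unfolding two_sided_ideal_def by blast+

lemma equivp_grassmann_rel: "equivp grassmann_rel"
proof (rule equivpI)
  show "reflp grassmann_rel"
    by (auto simp: reflp_def grassmann_rel_def grassmann_ideal_zero)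
  show "symp grassmann_rel"
    unfolding symp_def grassmann_rel_def by (auto dest: grassmann_ideal_uminus)
  show "transp grassmann_rel"
    unfolding transp_def grassmann_rel_def by (auto dest: grassmann_ideal_add)
qed

text \<open>
  \<open>('n, 'k) grassmann\<close> is the Grassmann algebra over \<open>'k\<close> with one generator for each element
  of \<open>'n\<close>; for finite \<open>'n\<close> the number of generators is \<open>CARD('n)\<close>. The product
  \<open>\<and>\<close> is the ring multiplication.
\<close>

quotient_type (overloaded) ('n, 'k) grassmann = "'n word \<Rightarrow>\<^sub>0 'k::comm_ring_1" / grassmann_rel
  by (rule equivp_grassmann_rel)

lemma lookup_mult_zero_word:
  "Poly_Mapping.lookup (p * q) (0::'x word) = Poly_Mapping.lookup p 0 * Poly_Mapping.lookup q 0"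
proof -
  have split: "(0 = u + v) \<longleftrightarrow> u = 0 \<and> v = 0" for u v :: "'x word"
    by (cases u; cases v) (auto simp: zero_word_def plus_word_def)
  have eq: "Sum_any (\<lambda>v. Poly_Mapping.lookup q v when 0 = u + v) = (Poly_Mapping.lookup q 0 when u = 0)"
    for u :: "'x word"
  proof -
    have "(\<lambda>v. Poly_Mapping.lookup q v when 0 = u + v)
        = (\<lambda>v. (Poly_Mapping.lookup q v when u = 0) when v = 0)"
      by (rule ext) (simp only: split when_when conj_commute)
    then show ?thesis by (simp only: Sum_any_when_equal)
  qed
  show ?thesis by (simp only: lookup_mult eq mult_when Sum_any_when_equal)
qed

lemma one_notin_grassmann_ideal: "(1 :: 'n word \<Rightarrow>\<^sub>0 'k::comm_ring_1) \<notin> grassmann_ideal"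
proof -
  let ?J = "{p :: 'n word \<Rightarrow>\<^sub>0 'k. Poly_Mapping.lookup p 0 = 0}"
  have "two_sided_ideal ?J"
    by (auto simp: two_sided_ideal_def lookup_add lookup_mult_zero_word)
  moreover have "grassmann_relations \<subseteq> ?J"
    by (auto simp: grassmann_relations_def lookup_add lookup_mult_zero_word free_gen_def)
      (simp_all add: lookup_single zero_word_def)
  ultimately have "grassmann_ideal \<subseteq> ?J"
    unfolding grassmann_ideal_def by (rule hull_minimal[rotated])
  then show ?thesis by auto
qed

instantiation grassmann :: (type, comm_ring_1) ring_1
begin

lift_definition zero_grassmann :: "('a, 'b) grassmann" is 0 .

lift_definition one_grassmann :: "('a, 'b) grassmann" is 1 .

lift_definition plus_grassmann :: "('a, 'b) grassmann \<Rightarrow> ('a, 'b) grassmann \<Rightarrow> ('a, 'b) grassmann"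
  is "(+)"
  unfolding grassmann_rel_def by (simp only: add_diff_add grassmann_ideal_add)

lift_definition uminus_grassmann :: "('a, 'b) grassmann \<Rightarrow> ('a, 'b) grassmann" is uminus
  unfolding grassmann_rel_def by (simp only: minus_diff_minus grassmann_ideal_uminus)

lift_definition minus_grassmann :: "('a, 'b) grassmann \<Rightarrow> ('a, 'b) grassmann \<Rightarrow> ('a, 'b) grassmann"
  is "(-)"
proof -
  fix p p' q q' :: "'a word \<Rightarrow>\<^sub>0 'b"
  assume "grassmann_rel p p'" "grassmann_rel q q'"
  then have "(p - p') - (q - q') \<in> grassmann_ideal"
    unfolding grassmann_rel_def by (rule grassmann_ideal_diff)
  then show "grassmann_rel (p - q) (p' - q')"
    by (simp add: grassmann_rel_def algebra_simps)
qed

lift_definition times_grassmann :: "('a, 'b) grassmann \<Rightarrow> ('a, 'b) grassmann \<Rightarrow> ('a, 'b) grassmann"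
  is "(*)"
proof -
  fix p p' q q' :: "'a word \<Rightarrow>\<^sub>0 'b"
  assume "grassmann_rel p p'" "grassmann_rel q q'"
  then have "(p - p') * q + p' * (q - q') \<in> grassmann_ideal"
    unfolding grassmann_rel_def
    by (intro grassmann_ideal_add grassmann_ideal_mult_left grassmann_ideal_mult_right)
  then show "grassmann_rel (p * q) (p' * q')"
    by (simp add: grassmann_rel_def algebra_simps)
qed

instance
proof
  fix a b c :: "('a, 'b) grassmann"
  note refl = equivp_reflp[OF equivp_grassmann_rel]
  show "a + b + c = a + (b + c)" by transfer (simp add: add.assoc refl)
  show "a + b = b + a" by transfer (simp add: add.commute refl)
  show "0 + a = a" by transfer (simp add: refl)
  show "- a + a = 0" by transfer (simp add: refl)
  show "a - b = a + - b" by transfer (simp add: refl)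
  show "a * b * c = a * (b * c)" by transfer (simp add: mult.assoc refl)
  show "1 * a = a" by transfer (simp add: refl)
  show "a * 1 = a" by transfer (simp add: refl)
  show "(a + b) * c = a * c + b * c" by transfer (simp add: distrib_right refl)
  show "a * (b + c) = a * b + a * c" by transfer (simp add: distrib_left refl)
  show "(0::('a, 'b) grassmann) \<noteq> 1"
  proof (transfer, rule notI)
    assume "grassmann_rel 0 (1 :: 'a word \<Rightarrow>\<^sub>0 'b)"
    then have "- (0 - (1 :: 'a word \<Rightarrow>\<^sub>0 'b)) \<in> grassmann_ideal"
      unfolding grassmann_rel_def by (rule grassmann_ideal_uminus)
    then show False using one_notin_grassmann_ideal[where 'n = 'a and 'k = 'b] by simp
  qed
qed

end

lift_definition grassmann_gen :: "'n \<Rightarrow> ('n, 'k::comm_ring_1) grassmann" is free_gen .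

lift_definition grassmann_scale ::
    "'k::comm_ring_1 \<Rightarrow> ('n, 'k) grassmann \<Rightarrow> ('n, 'k) grassmann" is free_scale
  unfolding grassmann_rel_def free_scale_def
  by (simp only: grassmann_ideal_mult_left flip: right_diff_distrib)

lemma grassmann_gen_anticommute:
  "(grassmann_gen i * grassmann_gen j :: ('n, 'k::comm_ring_1) grassmann)
     = - (grassmann_gen j * grassmann_gen i)"
proof transfer
  fix i j :: 'n
  have "free_gen i * free_gen j - - (free_gen j * free_gen i)
      \<in> (grassmann_relations :: ('n word \<Rightarrow>\<^sub>0 'k) set)"
    unfolding grassmann_relations_def by blast
  then show "grassmann_rel (free_gen i * free_gen j) (- (free_gen j * free_gen i) :: 'n word \<Rightarrow>\<^sub>0 'k)"
    unfolding grassmann_rel_def grassmann_ideal_def by (rule hull_inc)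
qed

lemma grassmann_scale_mult_left: "grassmann_scale c (x * y) = grassmann_scale c x * y"
  by transfer (simp add: free_scale_def mult.assoc equivp_reflp[OF equivp_grassmann_rel])

lemma grassmann_scale_mult_right: "grassmann_scale c (x * y) = x * grassmann_scale c y"
proof transfer
  fix c :: 'b and x y :: "'a word \<Rightarrow>\<^sub>0 'b"
  have "free_scale c (x * y) = (x * Poly_Mapping.single 0 c) * y"
    by (simp add: free_scale_commutes) (simp add: free_scale_def mult.assoc)
  also have "\<dots> = x * free_scale c y"
    by (simp add: free_scale_def mult.assoc)
  finally show "grassmann_rel (free_scale c (x * y)) (x * free_scale c y)"
    by (simp add: equivp_reflp[OF equivp_grassmann_rel])
qed

interpretation grassmann: vector_space "grassmann_scale :: 'k::field \<Rightarrow> ('n, 'k) grassmann \<Rightarrow> _"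
proof
  fix a b :: 'k and x y :: "('n, 'k) grassmann"
  note refl = equivp_reflp[OF equivp_grassmann_rel]
  show "grassmann_scale a (x + y) = grassmann_scale a x + grassmann_scale a y"
    by transfer (simp add: free_scale_def distrib_left refl)
  show "grassmann_scale (a + b) x = grassmann_scale a x + grassmann_scale b x"
    by transfer (simp add: free_scale_def single_add distrib_right refl)
  show "grassmann_scale a (grassmann_scale b x) = grassmann_scale (a * b) x"
    by transfer (simp add: free_scale_def mult.assoc[symmetric] mult_single refl)
  show "grassmann_scale 1 x = x"
    by transfer (simp add: free_scale_def refl)
qed

text \<open>
  The empty product (\<open>i = 0\<close>, \<open>js = []\<close>) is \<open>1\<close>, so degree \<open>0\<close> is the line of scalars; for
  \<open>i > CARD('n)\<close> the component is zero.
\<close>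

definition grassmann_component :: "nat \<Rightarrow> ('n::linorder, 'k::field) grassmann set" where
  "grassmann_component i =
     grassmann.span {prod_list (map grassmann_gen js) | js. sorted_wrt (<) js \<and> length js = i}"

definition grassmann_scalars :: "('n, 'k::field) grassmann set" where
  "grassmann_scalars = range (\<lambda>c. grassmann_scale c 1)"

lemma grassmann_component_0: "grassmann_component 0 = grassmann_scalars"
proof -
  have "{prod_list (map grassmann_gen js) | js. sorted_wrt (<) js \<and> length js = 0}
      = {1 :: ('a::linorder, 'b::field) grassmann}"
    by force
  then show ?thesis
    by (simp add: grassmann_component_def grassmann_scalars_def grassmann.span_singleton)
qed


section \<open>Internal direct sums\<close>

text \<open>
  Meant for finite \<open>I\<close> (the big sum is \<open>0\<close> otherwise); the second conjunct is directness.
\<close>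

definition is_direct_sum :: "'i set \<Rightarrow> ('i \<Rightarrow> 'v::ab_group_add set) \<Rightarrow> 'v set \<Rightarrow> bool" where
  "is_direct_sum I V W \<longleftrightarrow>
     W = {\<Sum>i\<in>I. x i | x. \<forall>i\<in>I. x i \<in> V i} \<and>
     (\<forall>x. (\<forall>i\<in>I. x i \<in> V i) \<and> (\<Sum>i\<in>I. x i) = 0 \<longrightarrow> (\<forall>i\<in>I. x i = 0))"


section \<open>Automorphisms of algebras\<close>

definition algebra_automorphism :: "('k::field \<Rightarrow> 'a::ring_1 \<Rightarrow> 'a) \<Rightarrow> ('a \<Rightarrow> 'a) \<Rightarrow> bool" where
  "algebra_automorphism scale \<sigma> \<longleftrightarrow>
     Vector_Spaces.linear scale scale \<sigma> \<and> bij \<sigma> \<and> \<sigma> 1 = 1 \<and> (\<forall>x y. \<sigma> (x * y) = \<sigma> x * \<sigma> y)"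

definition Aut_stable :: "('k::field \<Rightarrow> 'a::ring_1 \<Rightarrow> 'a) \<Rightarrow> 'a set \<Rightarrow> bool" where
  "Aut_stable scale V \<longleftrightarrow> (\<forall>\<sigma>. algebra_automorphism scale \<sigma> \<longrightarrow> \<sigma> ` V \<subseteq> V)"


section \<open>The subspaces in the classification\<close>

definition form_a :: "('n::{finite,linorder}, 'k::field) grassmann set \<Rightarrow> bool" where
  "form_a B \<longleftrightarrow> (\<exists>j. even j \<and> 0 < j \<and> j \<le> CARD('n) \<and>
     is_direct_sum {k. j \<le> k \<and> k \<le> CARD('n) \<and> even k} grassmann_component B)"

definition form_b :: "('n::{finite,linorder}, 'k::field) grassmann set \<Rightarrow> bool" where
  "form_b B \<longleftrightarrow> (\<exists>j. 1 \<le> j \<and> j \<le> CARD('n) \<and>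
     is_direct_sum {j..CARD('n)} grassmann_component B)"

definition form_c :: "('n::{finite,linorder}, 'k::field) grassmann set \<Rightarrow> bool" where
  "form_c B \<longleftrightarrow> (\<exists>B1 B2. form_a B1 \<and> form_b B2 \<and> B = B1 + B2)"

definition form_d :: "('n::{finite,linorder}, 'k::field) grassmann set \<Rightarrow> bool" where
  "form_d B \<longleftrightarrow> (\<exists>B'. (B' = {0} \<or> form_a B' \<or> form_b B' \<or> form_c B') \<and> B = grassmann_scalars + B')"

end

theory Submission
  imports Defs
begin

text \<open>
  Write \<open>e\<^sub>S\<close> for the product of the generators in \<open>S\<close>, taken in increasing order. Automorphisms
  of four kinds suffice to pin down a stable subspace \<open>B\<close>.

  The sign changes \<open>e\<^sub>i \<mapsto> - e\<^sub>i\<close> act on \<open>e\<^sub>S\<close> by \<open>\<plusminus>1\<close>, and they distinguish different sets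
  \<open>S\<close> because the characteristic is not \<open>2\<close>. So \<open>B\<close> contains each term \<open>c\<^sub>S e\<^sub>S\<close> of each of its
  elements (\<open>stable_term\<close>). Signs are available even
  over the field with three elements, whereas general rescalings need more scalars. Permutations of the generators then show
  that \<open>B\<close> is the sum of the components of degree in some set \<open>K\<close>. The substitution
  \<open>e\<^sub>a \<mapsto> e\<^sub>a + e\<^sub>a e\<^sub>b e\<^sub>c\<close> passes from a degree \<open>k \<ge> 1\<close> in \<open>K\<close> to \<open>k + 2\<close>, and conjugation by
  \<open>1 + e\<^sub>a\<close>, which adds \<open>2 e\<^sub>a x\<close> to an odd monomial \<open>x\<close>, passes from an odd degree \<open>k\<close> to \<open>k + 1\<close>
  (\<open>stable_eq_graded\<close>). The sets of positive degrees with these closure properties are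
  those in the classification (\<open>degree_set_cases\<close>); degree \<open>0\<close> is subject to no condition and
  accounts for the summand of scalars.

  Conversely, an automorphism \<open>\<sigma>\<close> maps \<open>e\<^sub>i\<close> to an element of square zero, hence without constant
  term, so \<open>\<sigma>\<close> cannot lower degrees. Further, \<open>2 \<sigma>(e\<^sub>i e\<^sub>j)\<close> is the commutator of \<open>\<sigma>(e\<^sub>i)\<close> and
  \<open>\<sigma>(e\<^sub>j)\<close>, and a commutator has only even components, as even monomials are central. Thus \<open>\<sigma>\<close>
  maps products of evenly many generators to even elements (\<open>hom_even_mon_graded\<close>).

  That sums of components are direct is again a consequence of \<open>stable_term\<close>, now for the stable
  subspace \<open>{0}\<close>: if a sum of terms \<open>c\<^sub>S e\<^sub>S\<close> over distinct \<open>S\<close> is zero, each term is zero.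
\<close>

section \<open>The universal property\<close>

text \<open>
  These are the defining relations of the Grassmann algebra, hence the condition under which
  \<open>e\<^sub>i \<mapsto> f i\<close> extends to an algebra endomorphism.
\<close>

definition anticommuting :: "('n \<Rightarrow> 'a::ring_1) \<Rightarrow> bool" where
  "anticommuting f \<longleftrightarrow> (\<forall>i j. f i * f j = - (f j * f i))"

lemma anticommutingD: "anticommuting f \<Longrightarrow> f i * f j = - (f j * f i)"
  unfolding anticommuting_def by blast

definition free_eval ::
    "('n \<Rightarrow> ('n, 'k::field) grassmann) \<Rightarrow> ('n word \<Rightarrow>\<^sub>0 'k) \<Rightarrow> ('n, 'k) grassmann" where
  "free_eval f p = (\<Sum>w\<in>Poly_Mapping.keys p.
     grassmann_scale (Poly_Mapping.lookup p w) (prod_list (map f (letters w))))"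

lemma free_eval_single:
  "free_eval f (Poly_Mapping.single w c) = grassmann_scale c (prod_list (map f (letters w)))"
  by (cases "c = 0") (simp_all add: free_eval_def lookup_single)

lemma free_eval_add: "free_eval f (p + q) = free_eval f p + free_eval f q"
  unfolding free_eval_def
  by (rule setsum_keys_plus_distrib) (simp_all add: grassmann.scale_left_distrib)

lemma free_eval_zero: "free_eval f 0 = 0"
  by (simp add: free_eval_def)

lemma free_eval_uminus: "free_eval f (- p) = - free_eval f p"
  using free_eval_add[of f p "- p"] by (simp add: free_eval_zero add_eq_0_iff)

lemma poly_mapping_single_add_induct:
  fixes p :: "'x \<Rightarrow>\<^sub>0 'k::comm_monoid_add"
  assumes "\<And>w c. P (Poly_Mapping.single w c)" and "\<And>p q. P p \<Longrightarrow> P q \<Longrightarrow> P (p + q)"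
  shows "P p"
proof (induction p rule: update_induct)
  case const
  show ?case using assms(1)[of undefined 0] by simp
next
  case (update f w c)
  have "Poly_Mapping.update w c f = f + Poly_Mapping.single w c"
    using update.hyps(1)
    by (intro poly_mapping_eqI) (auto simp: lookup_update lookup_add lookup_single when_def in_keys_iff)
  then show ?case using update assms by simp
qed

lemma free_eval_mult: "free_eval f (p * q) = free_eval f p * free_eval f q"
proof (induction p rule: poly_mapping_single_add_induct)
  case (1 u a)
  show ?case
  proof (induction q rule: poly_mapping_single_add_induct)
    case (1 v b)
    have "grassmann_scale (a * b) (x * y) = grassmann_scale a x * grassmann_scale b y"
      for x y :: "('a, 'b) grassmann"
      by (metis grassmann.scale_scale grassmann_scale_mult_left grassmann_scale_mult_right)
    then show ?case
      by (simp add: mult_single free_eval_single plus_word_def)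
  qed (simp add: distrib_left free_eval_add)
qed (simp add: distrib_right free_eval_add)

text \<open>
  The elements killed by an evaluation form a two-sided ideal, so it suffices to look at the
  defining relations.
\<close>

lemma free_eval_grassmann_ideal:
  assumes "anticommuting f" and "p \<in> grassmann_ideal"
  shows "free_eval f p = 0"
proof -
  let ?J = "{p. free_eval f p = 0}"
  have "two_sided_ideal ?J"
    by (auto simp: two_sided_ideal_def free_eval_zero free_eval_add free_eval_mult)
  moreover have "grassmann_relations \<subseteq> ?J"
  proof -
    have "free_eval f (free_gen i * free_gen j - - (free_gen j * free_gen i)) = 0" for i j
      using anticommutingD[OF assms(1), of i j]
      by (simp only: diff_minus_eq_add free_eval_add free_eval_mult free_gen_def free_eval_single
          word.sel list.map prod_list.Cons prod_list.Nil mult_1_right grassmann.scale_one left_minus)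
    then show ?thesis unfolding grassmann_relations_def by blast
  qed
  ultimately have "grassmann_ideal \<subseteq> ?J"
    unfolding grassmann_ideal_def by (rule hull_minimal[rotated])
  then show ?thesis using assms(2) by auto
qed

text \<open>
  For anticommuting \<open>f\<close> this is the endomorphism with \<open>e\<^sub>i \<mapsto> f i\<close>. For other \<open>f\<close> the value depends
  on the chosen representative and has no meaning.
\<close>

definition substitute ::
    "('n \<Rightarrow> ('n, 'k::field) grassmann) \<Rightarrow> ('n, 'k) grassmann \<Rightarrow> ('n, 'k) grassmann" where
  "substitute f x = free_eval f (rep_grassmann x)"

lemma substitute_abs:
  assumes "anticommuting f"
  shows "substitute f (abs_grassmann p) = free_eval f p"
proof -
  have "grassmann_rel (rep_grassmann (abs_grassmann p)) p"
    using Quotient_rep_abs[OF Quotient_grassmann] equivp_reflp[OF equivp_grassmann_rel] by blast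
  then have "free_eval f (rep_grassmann (abs_grassmann p) - p) = 0"
    unfolding grassmann_rel_def by (rule free_eval_grassmann_ideal[OF assms])
  then show ?thesis
    using free_eval_add[of f "rep_grassmann (abs_grassmann p)" "- p"]
    by (simp add: substitute_def free_eval_uminus)
qed

lemma grassmann_abs_cases: obtains p where "x = abs_grassmann p"
  using Quotient_abs_rep[OF Quotient_grassmann] by metis

definition algebra_hom :: "(('n, 'k::field) grassmann \<Rightarrow> ('n, 'k) grassmann) \<Rightarrow> bool" where
  "algebra_hom \<sigma> \<longleftrightarrow>
     Vector_Spaces.linear grassmann_scale grassmann_scale \<sigma> \<and> \<sigma> 1 = 1 \<and>
     (\<forall>x y. \<sigma> (x * y) = \<sigma> x * \<sigma> y)"

lemma algebra_automorphism_iff: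
  "algebra_automorphism grassmann_scale \<sigma> \<longleftrightarrow> algebra_hom \<sigma> \<and> bij \<sigma>"
  by (auto simp: algebra_automorphism_def algebra_hom_def)

lemma algebra_homI:
  assumes "\<And>x y. \<sigma> (x + y) = \<sigma> x + \<sigma> y" "\<And>c x. \<sigma> (grassmann_scale c x) = grassmann_scale c (\<sigma> x)"
    and "\<sigma> 1 = 1" "\<And>x y. \<sigma> (x * y) = \<sigma> x * \<sigma> y"
  shows "algebra_hom \<sigma>"
  using assms grassmann.vector_space_axioms by (simp add: algebra_hom_def Vector_Spaces.linear_iff)

lemma
  assumes "algebra_hom \<sigma>"
  shows algebra_hom_add: "\<sigma> (x + y) = \<sigma> x + \<sigma> y"
    and algebra_hom_scale: "\<sigma> (grassmann_scale c x) = grassmann_scale c (\<sigma> x)"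
    and algebra_hom_one: "\<sigma> 1 = 1"
    and algebra_hom_mult: "\<sigma> (x * y) = \<sigma> x * \<sigma> y"
  using assms by (simp_all add: algebra_hom_def Vector_Spaces.linear_iff)

lemma algebra_hom_zero: "algebra_hom \<sigma> \<Longrightarrow> \<sigma> 0 = 0"
  using algebra_hom_add[of \<sigma> 0 0] by simp

lemma algebra_hom_uminus: "algebra_hom \<sigma> \<Longrightarrow> \<sigma> (- x) = - \<sigma> x"
  using algebra_hom_add[of \<sigma> x "- x"] by (simp add: algebra_hom_zero add_eq_0_iff)

lemma algebra_hom_diff: "algebra_hom \<sigma> \<Longrightarrow> \<sigma> (x - y) = \<sigma> x - \<sigma> y"
  using algebra_hom_add[of \<sigma> x "- y"] by (simp add: algebra_hom_uminus)

lemma algebra_hom_sum: "algebra_hom \<sigma> \<Longrightarrow> \<sigma> (\<Sum>i\<in>I. x i) = (\<Sum>i\<in>I. \<sigma> (x i))"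
  by (induction I rule: infinite_finite_induct) (auto simp: algebra_hom_zero algebra_hom_add)

lemma algebra_hom_prod_list: "algebra_hom \<sigma> \<Longrightarrow> \<sigma> (prod_list (map f js)) = prod_list (map (\<lambda>i. \<sigma> (f i)) js)"
  by (induction js) (simp_all add: algebra_hom_one algebra_hom_mult)

lemma algebra_hom_substitute:
  assumes "anticommuting f"
  shows "algebra_hom (substitute f)"
proof (rule algebra_homI)
  fix x y :: "('a, 'b) grassmann" and c
  obtain p where p: "x = abs_grassmann p" by (rule grassmann_abs_cases)
  obtain q where q: "y = abs_grassmann q" by (rule grassmann_abs_cases)
  show "substitute f (x + y) = substitute f x + substitute f y"
    by (simp add: p q plus_grassmann.abs_eq substitute_abs assms free_eval_add)
  show "substitute f (x * y) = substitute f x * substitute f y"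
    by (simp add: p q times_grassmann.abs_eq substitute_abs assms free_eval_mult)
  show "substitute f (grassmann_scale c x) = grassmann_scale c (substitute f x)"
    using grassmann_scale_mult_left[of c 1 "free_eval f p"]
    by (simp add: p grassmann_scale.abs_eq substitute_abs assms free_scale_def free_eval_mult
        free_eval_single zero_word_def)
  have "free_eval f 1 = 1"
    by (simp add: free_eval_single zero_word_def flip: single_one)
  then show "substitute f 1 = 1"
    by (metis one_grassmann.abs_eq substitute_abs[OF assms])
qed

lemma substitute_gen:
  assumes "anticommuting f"
  shows "substitute f (grassmann_gen i) = f i"
  by (simp add: grassmann_gen.abs_eq substitute_abs assms free_gen_def free_eval_single)

abbreviation mon :: "'n list \<Rightarrow> ('n, 'k::field) grassmann" where
  "mon js \<equiv> prod_list (map grassmann_gen js)"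

lemma substitute_mon:
  "anticommuting f \<Longrightarrow> substitute f (mon js) = prod_list (map f js)"
  by (simp add: algebra_hom_prod_list algebra_hom_substitute substitute_gen)

lemma span_words: "grassmann.span (range mon) = (UNIV :: ('n, 'k::field) grassmann set)"
proof -
  have "abs_grassmann p \<in> grassmann.span (range mon)" for p :: "'n word \<Rightarrow>\<^sub>0 'k"
  proof (induction p rule: poly_mapping_single_add_induct)
    case (1 w c)
    have word: "abs_grassmann (Poly_Mapping.single (Word js) 1) = (mon js :: ('n, 'k) grassmann)" for js
    proof (induction js)
      case Nil
      then show ?case by (simp add: one_grassmann.abs_eq flip: zero_word_def)
    next
      case (Cons i js)
      have "Poly_Mapping.single (Word (i # js)) (1::'k) = free_gen i * Poly_Mapping.single (Word js) 1"
        by (simp add: free_gen_def mult_single plus_word_def)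
      then show ?case
        by (simp add: Cons grassmann_gen.abs_eq flip: times_grassmann.abs_eq)
    qed
    have "Poly_Mapping.single w c = free_scale c (Poly_Mapping.single w 1)"
      by (simp add: free_scale_def mult_single)
    then have "abs_grassmann (Poly_Mapping.single w c) = grassmann_scale c (mon (letters w))"
      using word[of "letters w"] by (simp flip: grassmann_scale.abs_eq)
    then show ?case by (simp add: grassmann.span_base grassmann.span_scale)
  next
    case (2 p q)
    then show ?case
      by (simp add: grassmann.span_add flip: plus_grassmann.abs_eq)
  qed
  then show ?thesis using grassmann_abs_cases by (metis UNIV_eq_I)
qed

lemma algebra_hom_ext:
  assumes "algebra_hom \<sigma>" "algebra_hom \<tau>"
    and "\<And>i. \<sigma> (grassmann_gen i) = \<tau> (grassmann_gen i)"
  shows "\<sigma> x = \<tau> x"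
proof -
  have "x \<in> grassmann.span (range mon)" by (simp add: span_words)
  then show ?thesis
  proof (induction rule: grassmann.span_induct_alt)
    case base
    then show ?case by (simp add: assms algebra_hom_zero)
  next
    case (step c x y)
    then obtain js where "x = mon js" by auto
    then have "\<sigma> x = \<tau> x"
      by (simp add: assms algebra_hom_prod_list)
    then show ?case using step by (simp add: assms algebra_hom_add algebra_hom_scale)
  qed
qed

text \<open>
  Both composites fix the generators, hence they are the identity. So bijectivity of a
  substitution is checked on generators only.
\<close>

lemma algebra_automorphism_substitute:
  assumes f: "anticommuting f" and g: "anticommuting g"
    and fg: "\<And>i. substitute f (g i) = grassmann_gen i" and gf: "\<And>i. substitute g (f i) = grassmann_gen i"
  shows "algebra_automorphism grassmann_scale (substitute f)"
proof -
  note hom = algebra_hom_substitute[OF f] algebra_hom_substitute[OF g]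
  have comp: "algebra_hom (\<lambda>x. \<sigma> (\<tau> x))" if "algebra_hom \<sigma>" "algebra_hom \<tau>"
    for \<sigma> \<tau> :: "('a, 'b) grassmann \<Rightarrow> _"
    by (rule algebra_homI) (simp_all add: that algebra_hom_add algebra_hom_scale algebra_hom_one algebra_hom_mult)
  have ident: "algebra_hom (\<lambda>x :: ('a, 'b) grassmann. x)"
    by (rule algebra_homI) simp_all
  have "substitute f (substitute g x) = x" for x
    by (rule algebra_hom_ext[OF comp[OF hom] ident]) (simp add: substitute_gen f g fg)
  moreover have "substitute g (substitute f x) = x" for x
    by (rule algebra_hom_ext[OF comp[OF hom(2,1)] ident]) (simp add: substitute_gen f g gf)
  ultimately have "bij (substitute f)"
    by (metis bijI')
  then show ?thesis using hom by (simp add: algebra_automorphism_iff)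
qed

section \<open>Monomials and graded subspaces\<close>

lemma gen_swap: "grassmann_gen i * (grassmann_gen j * x) = - (grassmann_gen j * (grassmann_gen i * x))"
proof -
  have "grassmann_gen i * (grassmann_gen j * x) = - (grassmann_gen j * grassmann_gen i) * x"
    unfolding mult.assoc[symmetric] by (subst grassmann_gen_anticommute) (rule refl)
  then show ?thesis by (simp add: mult.assoc)
qed

lemma gen_mult_mon:
  "grassmann_gen i * mon js =
     (if even (length js) then mon js * grassmann_gen i else - (mon js * grassmann_gen i))"
proof (induction js)
  case (Cons j js)
  then show ?case by (simp add: gen_swap[of i j] mult.assoc)
qed simp

lemma mon_mult_mon:
  "(mon js * mon ks :: ('n, 'k::field) grassmann) =
     (if even (length js) \<or> even (length ks) then mon ks * mon js else - (mon ks * mon js))"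
proof (induction js)
  case (Cons i js)
  have "(mon (i # js) * mon ks :: ('n, 'k) grassmann) = grassmann_gen i * (mon js * mon ks)"
    by (simp add: mult.assoc)
  also have "\<dots> = (if even (length js) \<or> even (length ks) then grassmann_gen i * mon ks * mon js
      else - (grassmann_gen i * mon ks * mon js))"
    unfolding Cons by (simp add: mult.assoc)
  also have "\<dots> = (if even (length (i # js)) \<or> even (length ks) then mon ks * mon (i # js)
      else - (mon ks * mon (i # js)))"
    by (auto simp: gen_mult_mon mult.assoc)
  finally show ?case .
qed simp

text \<open>
  For infinite \<open>S\<close> the sorted list is empty and the value is \<open>1\<close>; only finite \<open>S\<close> matter.
\<close>

definition set_mon :: "'n::linorder set \<Rightarrow> ('n, 'k::field) grassmann" where
  "set_mon S = mon (sorted_list_of_set S)"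

lemma mon_insort:
  "(mon (insort i js) :: ('n::linorder, 'k::field) grassmann) \<in> {mon (i # js), - mon (i # js)}"
proof (induction js)
  case (Cons j js)
  have "grassmann_gen j * mon (insort i js) \<in>
      {grassmann_gen j * (grassmann_gen i * mon js), - (grassmann_gen j * (grassmann_gen i * mon js))
        :: ('n, 'k) grassmann}"
    using Cons by auto
  then have "grassmann_gen j * mon (insort i js) \<in>
      {grassmann_gen i * (grassmann_gen j * mon js), - (grassmann_gen i * (grassmann_gen j * mon js))
        :: ('n, 'k) grassmann}"
    by (simp add: gen_swap[of j i] disj_commute)
  then show ?case by simp
qed simp

text \<open>
  Sorting a word with the anticommutation relation costs only a sign, so a subspace contains a
  square-free word as soon as it contains some rearrangement of it. This allows arguments with words
  in whichever order is convenient.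
\<close>

lemma mon_set_mon:
  "distinct js \<Longrightarrow>
    (mon js :: ('n::linorder, 'k::field) grassmann) \<in> {set_mon (set js), - set_mon (set js)}"
proof (induction js)
  case (Cons i js)
  let ?x = "grassmann_gen i * set_mon (set js) :: ('n, 'k) grassmann"
  have "set js - {i} = set js" using Cons.prems by auto
  then have "set_mon (set (i # js)) = (mon (insort i (sorted_list_of_set (set js))) :: ('n, 'k) grassmann)"
    by (simp add: set_mon_def)
  then have "set_mon (set (i # js)) \<in> {?x, - ?x}"
    using mon_insort[of i "sorted_list_of_set (set js)", where 'k = 'k] by (simp add: set_mon_def)
  moreover have "mon (i # js) \<in> {?x, - ?x}"
    using Cons by auto
  ultimately show ?case by auto
qed (simp add: set_mon_def)

lemma mon_subspace_iff:
  assumes "grassmann.subspace B" "distinct js"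
  shows "mon js \<in> B \<longleftrightarrow> set_mon (set js) \<in> B"
proof -
  have "- x \<in> B \<longleftrightarrow> x \<in> B" for x
    using grassmann.subspace_neg[OF assms(1)] by (metis minus_minus)
  then show ?thesis using mon_set_mon[OF assms(2)] by (metis insertE singletonD)
qed

text \<open>
  Infinite sets of degrees are convenient here: over finitely many generators the degrees beyond
  their number contribute no sets \<open>S\<close>.
\<close>

definition graded :: "nat set \<Rightarrow> ('n::linorder, 'k::field) grassmann set" where
  "graded K = grassmann.span (set_mon ` {S. finite S \<and> card S \<in> K})"

lemma subspace_graded: "grassmann.subspace (graded K)"
  unfolding graded_def by (rule grassmann.subspace_span)

lemma graded_mono: "K \<subseteq> L \<Longrightarrow> graded K \<subseteq> graded L"
  unfolding graded_def by (rule grassmann.span_mono) auto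

lemma set_mon_graded: "finite S \<Longrightarrow> card S \<in> K \<Longrightarrow> set_mon S \<in> graded K"
  unfolding graded_def by (rule grassmann.span_base) auto

lemma graded_Un: "graded (K \<union> L) = graded K + (graded L :: ('n::linorder, 'k::field) grassmann set)"
proof -
  have "{S. finite S \<and> card S \<in> K \<union> L} = {S :: 'n set. finite S \<and> card S \<in> K} \<union> {S. finite S \<and> card S \<in> L}"
    by blast
  then show ?thesis
    unfolding graded_def set_plus_def by (simp only: image_Un grassmann.span_Un) blast
qed

lemma graded_empty: "graded {} = {0}"
  by (simp add: graded_def)

lemma graded_restrict:
  "graded (K \<inter> {..CARD('n)}) = (graded K :: ('n::{finite,linorder}, 'k::field) grassmann set)"
  unfolding graded_def by (rule arg_cong[of _ _ "\<lambda>X. grassmann.span (set_mon ` X)"])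
    (auto intro: card_mono)

lemma grassmann_component_eq_graded: "grassmann_component i = graded {i}"
proof -
  have "{mon js | js. sorted_wrt (<) js \<and> length js = i} =
      (set_mon ` {S. finite S \<and> card S \<in> {i}} :: ('a, 'b) grassmann set)" (is "?L = ?R")
  proof
    show "?L \<subseteq> ?R"
    proof
      fix x assume "x \<in> ?L"
      then obtain js where "x = mon js" "sorted_wrt (<) js" "length js = i" by auto
      then have "x = set_mon (set js)" "card (set js) = i"
        by (auto simp: set_mon_def strict_sorted_iff sorted_list_of_set.idem_if_sorted_distinct
            distinct_card)
      then show "x \<in> ?R" by auto
    qed
    show "?R \<subseteq> ?L"
    proof
      fix x assume "x \<in> ?R"
      then obtain S where "x = set_mon S" "finite S" "card S = i" by auto
      then show "x \<in> ?L"
        by (auto simp: set_mon_def intro!: exI[of _ "sorted_list_of_set S"])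
    qed
  qed
  then show ?thesis by (simp add: grassmann_component_def graded_def)
qed

lemma grassmann_scalars_eq_graded: "grassmann_scalars = graded {0}"
  by (simp add: grassmann_component_eq_graded flip: grassmann_component_0)

lemma graded_expansion:
  fixes x :: "('n::{finite,linorder}, 'k::field) grassmann"
  assumes "x \<in> graded K"
  obtains c where "x = (\<Sum>S | card S \<in> K. grassmann_scale (c S) (set_mon S))"
proof -
  have "\<exists>c. x = (\<Sum>S | card S \<in> K. grassmann_scale (c S) (set_mon S))"
    using assms unfolding graded_def
  proof (induction rule: grassmann.span_induct_alt)
    case base
    show ?case by (rule exI[of _ "\<lambda>_. 0"]) simp
  next
    case (step a x y)
    then obtain T c where T: "x = set_mon T" "card T \<in> K"
      and c: "y = (\<Sum>S | card S \<in> K. grassmann_scale (c S) (set_mon S))" by auto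
    have "(\<Sum>S | card S \<in> K. grassmann_scale (if S = T then a else 0) (set_mon S)) =
        (\<Sum>S | card S \<in> K. if S = T then grassmann_scale a (set_mon S) else 0)"
      by (rule sum.cong) auto
    also have "\<dots> = grassmann_scale a x" using T by simp
    finally have "grassmann_scale a x + y =
        (\<Sum>S | card S \<in> K. grassmann_scale ((if S = T then a else 0) + c S) (set_mon S))"
      by (simp only: c grassmann.scale_left_distrib sum.distrib)
    then show ?case by (rule exI[of _ "\<lambda>S. (if S = T then a else 0) + c S"])
  qed
  then show ?thesis using that by blast
qed

lemma sum_graded:
  fixes K :: "nat set"
  assumes "finite K"
  shows "(\<Sum>i\<in>K. \<Sum>S | card S = i. t S) = (\<Sum>S | card S \<in> K. t (S :: 'n::finite set))"
proof -
  have "(\<Sum>S | card S \<in> K. t S) = (\<Sum>i\<in>K. \<Sum>S | S \<in> {S. card S \<in> K} \<and> card S = i. t S)"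
    using assms by (intro sum.group[symmetric]) auto
  also have "\<dots> = (\<Sum>i\<in>K. \<Sum>S | card S = i. t S)"
    by (intro sum.cong refl) auto
  finally show ?thesis by simp
qed

section \<open>Stability and automorphisms in arbitrary characteristic\<close>

lemma Aut_stableD: "Aut_stable scale B \<Longrightarrow> algebra_automorphism scale \<sigma> \<Longrightarrow> x \<in> B \<Longrightarrow> \<sigma> x \<in> B"
  unfolding Aut_stable_def by blast

lemma stable_zero: "Aut_stable grassmann_scale ({0} :: ('n, 'k::field) grassmann set)"
  by (auto simp: Aut_stable_def algebra_automorphism_iff algebra_hom_zero)

lemma stable_scalars: "Aut_stable grassmann_scale (grassmann_scalars :: ('n, 'k::field) grassmann set)"
  by (auto simp: Aut_stable_def algebra_automorphism_iff grassmann_scalars_def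
      algebra_hom_scale algebra_hom_one)

lemma stable_plus:
  fixes A B :: "('n, 'k::field) grassmann set"
  assumes "Aut_stable grassmann_scale A" "Aut_stable grassmann_scale B"
  shows "Aut_stable grassmann_scale (A + B)"
  unfolding Aut_stable_def
proof (intro allI impI subsetI)
  fix \<sigma> y
  assume \<sigma>: "algebra_automorphism grassmann_scale \<sigma>" and "y \<in> \<sigma> ` (A + B)"
  then obtain a b where ab: "y = \<sigma> (a + b)" "a \<in> A" "b \<in> B" by (auto simp: set_plus_def)
  then have "y = \<sigma> a + \<sigma> b"
    using \<sigma> by (simp add: algebra_automorphism_iff algebra_hom_add)
  then show "y \<in> A + B"
    using ab Aut_stableD[OF assms(1) \<sigma>] Aut_stableD[OF assms(2) \<sigma>] by (auto simp: set_plus_def)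
qed

lemma stable_gradedI:
  fixes K :: "nat set"
  assumes "\<And>(\<sigma> :: ('n::linorder, 'k::field) grassmann \<Rightarrow> _) js.
      algebra_hom \<sigma> \<Longrightarrow> length js \<in> K \<Longrightarrow> \<sigma> (mon js) \<in> graded K"
  shows "Aut_stable grassmann_scale (graded K :: ('n, 'k) grassmann set)"
proof -
  have "\<sigma> x \<in> graded K"
    if \<sigma>: "algebra_hom \<sigma>" and x: "x \<in> graded K" for \<sigma> and x :: "('n, 'k) grassmann"
    using x unfolding graded_def
  proof (induction rule: grassmann.span_induct_alt)
    case base
    then show ?case by (simp add: algebra_hom_zero[OF \<sigma>] grassmann.span_zero)
  next
    case (step c s y)
    then have "\<sigma> s \<in> graded K"
      using assms[OF \<sigma>] by (auto simp: set_mon_def)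
    then show ?case
      using step by (simp add: algebra_hom_add[OF \<sigma>] algebra_hom_scale[OF \<sigma>] graded_def
          grassmann.span_add grassmann.span_scale)
  qed
  then show ?thesis by (auto simp: Aut_stable_def algebra_automorphism_iff)
qed

text \<open>
  Multiplicativity uses \<open>v u = 1\<close>; the inverse is \<open>x \<mapsto> v x u\<close>.
\<close>

lemma automorphism_conj:
  fixes u v :: "('n, 'k::field) grassmann"
  assumes "u * v = 1" "v * u = 1"
  shows "algebra_automorphism grassmann_scale (\<lambda>x. u * x * v)"
proof -
  have cancel: "v * (u * x) = x" "u * (v * x) = x" for x
    using assms by (simp_all flip: mult.assoc)
  have "algebra_hom (\<lambda>x. u * x * v)"
    by (rule algebra_homI)
      (simp_all add: distrib_left distrib_right mult.assoc cancel assms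
        flip: grassmann_scale_mult_left grassmann_scale_mult_right)
  moreover have "bij (\<lambda>x. u * x * v)"
    by (rule bijI'[where ?f = "\<lambda>x. u * x * v"]; metis cancel assms mult.assoc mult.right_neutral)
  ultimately show ?thesis by (simp add: algebra_automorphism_iff)
qed

lemma anticommuting_gen_comp: "anticommuting (grassmann_gen \<circ> \<rho>)"
  unfolding anticommuting_def comp_apply by (intro allI grassmann_gen_anticommute)

lemma automorphism_permute:
  assumes "bij \<pi>"
  shows "algebra_automorphism grassmann_scale
    (substitute (grassmann_gen \<circ> \<pi>) :: ('n, 'k::field) grassmann \<Rightarrow> _)"
  by (rule algebra_automorphism_substitute[OF anticommuting_gen_comp anticommuting_gen_comp[of "inv \<pi>"]])
    (use assms in \<open>simp_all add: substitute_gen[OF anticommuting_gen_comp]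
      bij_is_surj surj_f_inv_f bij_is_inj inv_f_f\<close>)

lemma stable_same_card:
  fixes B :: "('n::{finite,linorder}, 'k::field) grassmann set"
  assumes B: "grassmann.subspace B" "Aut_stable grassmann_scale B"
    and "set_mon S \<in> B" "card S = card T"
  shows "set_mon T \<in> B"
proof -
  obtain f where f: "bij_betw f S T"
    using assms(4) by (meson finite finite_same_card_bij)
  have "card (- S) = card (- T)" using assms(4) by (simp add: Compl_eq_Diff_UNIV card_Diff_subset)
  then obtain g where g: "bij_betw g (- S) (- T)"
    by (meson finite finite_same_card_bij)
  \<comment> \<open>A bijection \<open>S \<rightarrow> T\<close> has to be completed to a permutation of all the generators.\<close>
  define \<pi> where "\<pi> x = (if x \<in> S then f x else g x)" for x
  have "bij_betw \<pi> S T"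
    using f by (subst bij_betw_cong[of S \<pi> f]) (auto simp: \<pi>_def)
  moreover have "bij_betw \<pi> (- S) (- T)"
    using g by (subst bij_betw_cong[of "- S" \<pi> g]) (auto simp: \<pi>_def)
  ultimately have bij: "bij \<pi>"
    using bij_betw_combine[of \<pi> S T "- S" "- T"] by simp
  define js where "js = map \<pi> (sorted_list_of_set S)"
  have "distinct js" "set js = T"
    using bij \<open>bij_betw \<pi> S T\<close> by (auto simp: js_def distinct_map bij_betw_def)
  have "substitute (grassmann_gen \<circ> \<pi>) (set_mon S) \<in> B"
    by (rule Aut_stableD[OF B(2) automorphism_permute[OF bij] assms(3)])
  then have "mon js \<in> B"
    by (simp add: set_mon_def substitute_mon[OF anticommuting_gen_comp] js_def)
  then show ?thesis
    using mon_subspace_iff[OF B(1) \<open>distinct js\<close>] \<open>set js = T\<close> by simp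
qed

lemma anticommuting_gen_update:
  assumes "u * u = 0" and "\<And>i. i \<noteq> a \<Longrightarrow> u * grassmann_gen i = - (grassmann_gen i * u)"
  shows "anticommuting (grassmann_gen(a := u))"
  unfolding anticommuting_def
proof (intro allI)
  fix i j
  show "(grassmann_gen(a := u)) i * (grassmann_gen(a := u)) j =
      - ((grassmann_gen(a := u)) j * (grassmann_gen(a := u)) i)"
  proof (cases "i = a")
    case True
    then show ?thesis using assms by simp
  next
    case False
    show ?thesis
    proof (cases "j = a")
      case True
      then show ?thesis using False assms(2)[of i] by simp
    next
      case False
      then show ?thesis using \<open>i \<noteq> a\<close> grassmann_gen_anticommute[of i j] by simp
    qed
  qed
qed

abbreviation sign_change :: "'n \<Rightarrow> ('n, 'k::field) grassmann \<Rightarrow> ('n, 'k) grassmann" where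
  "sign_change i \<equiv> substitute (grassmann_gen(i := - grassmann_gen i))"

text \<open>
  All odd elements anticommute, so adding the cubic term keeps the relations.
\<close>

abbreviation cubic :: "'n \<Rightarrow> 'n \<Rightarrow> 'n \<Rightarrow> 'n \<Rightarrow> ('n, 'k::field) grassmann" where
  "cubic a b c \<equiv> grassmann_gen(a := grassmann_gen a + mon [a, b, c])"

section \<open>Products and commutators of graded subspaces\<close>

context
  assumes two: "(2 :: 'k::field) \<noteq> 0"
begin

lemma double_eq_zero:
  fixes x :: "('n, 'k) grassmann"
  shows "x + x = 0 \<longleftrightarrow> x = 0"
proof -
  have "x + x = grassmann_scale 2 x"
    using grassmann.scale_left_distrib[of 1 1 x] by simp
  then show ?thesis using two by simp
qed

lemma double_in_subspace:
  fixes x :: "('n, 'k) grassmann"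
  assumes "grassmann.subspace B" "x + x \<in> B"
  shows "x \<in> B"
proof -
  have "x + x = grassmann_scale 2 x"
    using grassmann.scale_left_distrib[of 1 1 x] by simp
  then have "grassmann_scale (inverse 2) (x + x) = x" using two by simp
  then show ?thesis using grassmann.subspace_scale[OF assms] by metis
qed

text \<open>
  The relations only give \<open>2 e\<^sub>i\<^sup>2 = 0\<close>, so a characteristic other than \<open>2\<close> is essential.
\<close>

lemma gen_square: "grassmann_gen i * grassmann_gen i = (0 :: ('n, 'k) grassmann)"
proof -
  have "grassmann_gen i * grassmann_gen i + grassmann_gen i * grassmann_gen i = (0 :: ('n, 'k) grassmann)"
    using grassmann_gen_anticommute[of i i] by (metis add.left_inverse)
  then show ?thesis by (simp only: double_eq_zero)
qed

lemma gen_mult_mon_eq_zero: "i \<in> set js \<Longrightarrow> grassmann_gen i * mon js = (0 :: ('n, 'k) grassmann)"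
proof (induction js)
  case (Cons j js)
  show ?case
  proof (cases "i = j")
    case True
    then show ?thesis by (simp add: gen_square flip: mult.assoc)
  next
    case False
    then show ?thesis using Cons by (simp add: gen_swap[of i])
  qed
qed simp

lemma mon_not_distinct: "\<not> distinct js \<Longrightarrow> mon js = (0 :: ('n, 'k) grassmann)"
  by (induction js) (auto simp: gen_mult_mon_eq_zero)

lemma mon_graded:
  assumes "length js \<in> K"
  shows "mon js \<in> (graded K :: ('n::linorder, 'k) grassmann set)"
proof (cases "distinct js")
  case True
  then show ?thesis
    using assms by (simp add: mon_subspace_iff subspace_graded set_mon_graded distinct_card)
next
  case False
  then show ?thesis by (simp add: mon_not_distinct grassmann.subspace_0 subspace_graded)
qed

lemma graded_UNIV: "graded UNIV = (UNIV :: ('n::linorder, 'k) grassmann set)"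
proof -
  have "grassmann.span (range mon) \<subseteq> (graded UNIV :: ('n, 'k) grassmann set)"
    by (rule grassmann.span_minimal) (auto simp: subspace_graded mon_graded)
  then show ?thesis by (auto simp: span_words)
qed

text \<open>
  A bilinear map is controlled by its values on monomials; used for the product and for the
  commutator.
\<close>

lemma graded_bilinear:
  fixes x y :: "('n::linorder, 'k) grassmann"
  assumes "grassmann.subspace B" "x \<in> graded J" "y \<in> graded K"
    and "\<And>x y z. h (x + y) z = h x z + h y z" "\<And>x y z. h x (y + z) = h x y + h x z"
    and "\<And>c x y. h (grassmann_scale c x) y = grassmann_scale c (h x y)"
      "\<And>c x y. h x (grassmann_scale c y) = grassmann_scale c (h x y)"
    and mon: "\<And>js ks. length js \<in> J \<Longrightarrow> length ks \<in> K \<Longrightarrow> h (mon js) (mon ks) \<in> B"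
  shows "h x y \<in> (B :: ('n, 'k) grassmann set)"
proof -
  have zero: "h 0 z = 0" "h z 0 = 0" for z
    using assms(4)[of 0 0 z] assms(5)[of z 0 0] by simp_all
  have left: "h x (mon ks) \<in> B" if "length ks \<in> K" for ks
    using assms(2) unfolding graded_def
  proof (induction rule: grassmann.span_induct_alt)
    case (step c s y)
    then obtain S where S: "s = set_mon S" "finite S" "card S \<in> J" by auto
    then have "h s (mon ks) \<in> B"
      using mon[of "sorted_list_of_set S" ks] that by (simp add: set_mon_def)
    then show ?case
      using step assms by (simp add: grassmann.subspace_add grassmann.subspace_scale)
  qed (simp add: zero grassmann.subspace_0 assms)
  show ?thesis
    using assms(3) unfolding graded_def
  proof (induction rule: grassmann.span_induct_alt)
    case (step c s y)
    then obtain S where S: "s = set_mon S" "finite S" "card S \<in> K" by auto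
    then have "h x s \<in> B"
      using left[of "sorted_list_of_set S"] by (simp add: set_mon_def)
    then show ?case
      using step assms by (simp add: grassmann.subspace_add grassmann.subspace_scale)
  qed (simp add: zero grassmann.subspace_0 assms)
qed

lemma graded_mult:
  fixes x y :: "('n::linorder, 'k) grassmann"
  assumes "x \<in> graded J" "y \<in> graded K" and "\<And>j k. j \<in> J \<Longrightarrow> k \<in> K \<Longrightarrow> j + k \<in> L"
  shows "x * y \<in> graded L"
proof (rule graded_bilinear[OF subspace_graded assms(1,2), where h = "(*)"])
  fix js ks :: "'n list"
  assume "length js \<in> J" "length ks \<in> K"
  then have "mon (js @ ks) \<in> (graded L :: ('n, 'k) grassmann set)"
    using assms(3) by (intro mon_graded) simp
  then show "mon js * mon ks \<in> (graded L :: ('n, 'k) grassmann set)" by simp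
qed (simp_all add: algebra_simps flip: grassmann_scale_mult_left grassmann_scale_mult_right)

text \<open>
  An even monomial is central, and the product of two odd ones has even degree at least \<open>2\<close>.
\<close>

lemma commutator_graded:
  fixes x y :: "('n::linorder, 'k) grassmann"
  assumes "x \<in> graded {1..}" "y \<in> graded {1..}"
  shows "x * y - y * x \<in> graded {k. 2 \<le> k \<and> even k}"
proof (rule graded_bilinear[OF subspace_graded assms, where h = "\<lambda>x y. x * y - y * x"])
  fix js ks :: "'n list"
  assume len: "length js \<in> {1..}" "length ks \<in> {1..}"
  show "mon js * mon ks - mon ks * mon js \<in> (graded {k. 2 \<le> k \<and> even k} :: ('n, 'k) grassmann set)"
  proof (cases "even (length js) \<or> even (length ks)")
    case True
    then show ?thesis
      using mon_mult_mon[of js ks, where 'k = 'k] by (simp add: grassmann.subspace_0 subspace_graded)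
  next
    case False
    then have "mon (js @ ks) \<in> (graded {k. 2 \<le> k \<and> even k} :: ('n, 'k) grassmann set)"
      using len by (intro mon_graded) auto
    moreover have "mon ks * mon js = - (mon js * mon ks :: ('n, 'k) grassmann)"
      using mon_mult_mon[of js ks, where 'k = 'k] False by simp
    ultimately show ?thesis
      by (simp add: grassmann.subspace_add subspace_graded)
  qed
qed (simp_all add: algebra_simps grassmann.scale_right_diff_distrib
    flip: grassmann_scale_mult_left grassmann_scale_mult_right)

section \<open>Separation of monomials by sign changes\<close>

lemma anticommuting_sign_change: "anticommuting (grassmann_gen(i := - grassmann_gen i :: ('n, 'k) grassmann))"
proof (rule anticommuting_gen_update)
  fix j assume "j \<noteq> i"
  show "- grassmann_gen i * grassmann_gen j = - (grassmann_gen j * - grassmann_gen i :: ('n, 'k) grassmann)"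
    using grassmann_gen_anticommute[of i j, where 'k = 'k] by simp
qed (simp add: gen_square)

lemma automorphism_sign_change:
  "algebra_automorphism grassmann_scale (sign_change i :: ('n, 'k) grassmann \<Rightarrow> _)"
proof -
  have "sign_change i ((grassmann_gen(i := - grassmann_gen i)) j) = (grassmann_gen j :: ('n, 'k) grassmann)" for j
    by (simp add: algebra_hom_uminus[OF algebra_hom_substitute] substitute_gen anticommuting_sign_change)
  then show ?thesis
    by (intro algebra_automorphism_substitute[OF anticommuting_sign_change anticommuting_sign_change])
qed

lemma sign_change_set_mon:
  assumes "finite S"
  shows "sign_change i (set_mon S) = (if i \<in> S then - set_mon S else (set_mon S :: ('n::linorder, 'k) grassmann))"
proof -
  let ?f = "grassmann_gen(i := - grassmann_gen i) :: 'n \<Rightarrow> ('n, 'k) grassmann"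
  have same: "map ?f js = map grassmann_gen js" if "i \<notin> set js" for js
    using that by (intro map_cong) auto
  show ?thesis
  proof (cases "i \<in> S")
    case False
    then show ?thesis
      using assms same[of "sorted_list_of_set S"]
      by (simp add: set_mon_def substitute_mon anticommuting_sign_change)
  next
    case True
    define js where "js = i # sorted_list_of_set (S - {i})"
    have js: "distinct js" "set js = S"
      using assms True by (auto simp: js_def)
    have "sign_change i (mon js) = (- mon js :: ('n, 'k) grassmann)"
      using assms same[of "sorted_list_of_set (S - {i})"]
      unfolding substitute_mon[OF anticommuting_sign_change] by (simp add: js_def)
    then have "sign_change i (- mon js) = - (- mon js :: ('n, 'k) grassmann)"
      by (simp add: algebra_hom_uminus[OF algebra_hom_substitute[OF anticommuting_sign_change]])
    moreover have "set_mon S \<in> {mon js, - mon js :: ('n, 'k) grassmann}"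
      using mon_set_mon[OF js(1), where 'k = 'k] js(2) by auto
    ultimately show ?thesis
      using \<open>sign_change i (mon js) = (- mon js :: ('n, 'k) grassmann)\<close> True by auto
  qed
qed

text \<open>
  The sign changes multiply \<open>e\<^sub>S\<close> by \<open>\<plusminus>1\<close>, and for distinct sets \<open>S\<close> the systems of signs
  differ. So adding to an element of \<open>B\<close> its images, or subtracting them, isolates its terms.
\<close>

lemma stable_term:
  fixes B :: "('n::{finite,linorder}, 'k) grassmann set"
  assumes B: "grassmann.subspace B" "Aut_stable grassmann_scale B"
    and "(\<Sum>S\<in>F. grassmann_scale (c S) (set_mon S)) \<in> B" and "T \<in> F"
  shows "grassmann_scale (c T) (set_mon T) \<in> B"
  using assms(3,4)
proof (induction "card F" arbitrary: F rule: less_induct)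
  case less
  let ?t = "\<lambda>S. grassmann_scale (c S) (set_mon S) :: ('n, 'k) grassmann"
  show ?case
  proof (cases "F = {T}")
    case True
    then show ?thesis using less.prems by simp
  next
    case False
    then obtain S where "S \<in> F" "S \<noteq> T" using less.prems(2) by blast
    \<comment> \<open>Changing the sign of a generator in exactly one of \<open>S\<close> and \<open>T\<close> separates the sum into
      two nonempty parts; the part with \<open>T\<close> is shorter, so the induction hypothesis applies to it.\<close>
    then obtain i where i: "i \<in> S \<longleftrightarrow> i \<notin> T" by blast
    define F1 where "F1 = {S \<in> F. i \<in> S}"
    define F0 where "F0 = {S \<in> F. i \<notin> S}"
    have F: "F = F1 \<union> F0" "F1 \<inter> F0 = {}" by (auto simp: F1_def F0_def)
    have x: "sum ?t F = sum ?t F1 + sum ?t F0"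
      unfolding F(1) by (rule sum.union_disjoint) (use F(2) in auto)
    note hom = algebra_hom_substitute[OF anticommuting_sign_change[of i]]
    have flip_t: "sign_change i (?t S) = (if i \<in> S then - ?t S else ?t S)" for S
      by (simp add: algebra_hom_scale[OF hom] sign_change_set_mon)
    have "sign_change i (sum ?t F1) = - sum ?t F1"
      unfolding algebra_hom_sum[OF hom] sum_negf[symmetric]
      by (rule sum.cong) (auto simp: flip_t F1_def)
    moreover have "sign_change i (sum ?t F0) = sum ?t F0"
      unfolding algebra_hom_sum[OF hom] by (rule sum.cong) (auto simp: flip_t F0_def)
    ultimately have flip_x: "sign_change i (sum ?t F) = sum ?t F0 - sum ?t F1"
      unfolding x by (simp add: algebra_hom_add[OF hom])
    have flip_B: "sign_change i (sum ?t F) \<in> B"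
      using Aut_stableD[OF B(2) automorphism_sign_change] less.prems(1) .
    have "sum ?t F + sign_change i (sum ?t F) = sum ?t F0 + sum ?t F0"
      unfolding flip_x by (simp add: x)
    then have "sum ?t F0 + sum ?t F0 \<in> B"
      using grassmann.subspace_add[OF B(1) less.prems(1) flip_B] by metis
    then have B0: "sum ?t F0 \<in> B" by (rule double_in_subspace[OF B(1)])
    have B1: "sum ?t F1 \<in> B"
      using grassmann.subspace_diff[OF B(1) less.prems(1) B0] by (simp add: x)
    show ?thesis
    proof (cases "i \<in> T")
      case True
      then have "F1 \<subset> F" "T \<in> F1" using i \<open>S \<in> F\<close> less.prems(2) by (auto simp: F1_def)
      then show ?thesis using less.hyps[OF _ B1] by (simp add: psubset_card_mono)
    next
      case False
      then have "F0 \<subset> F" "T \<in> F0" using i \<open>S \<in> F\<close> less.prems(2) by (auto simp: F0_def)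
      then show ?thesis using less.hyps[OF _ B0] by (simp add: psubset_card_mono)
    qed
  qed
qed

text \<open>
  The directness half holds by itself: \<open>{0}\<close> is stable, so a vanishing sum of terms has vanishing
  terms.
\<close>

lemma direct_sum_components_iff:
  fixes B :: "('n::{finite,linorder}, 'k) grassmann set"
  assumes "finite K"
  shows "is_direct_sum K grassmann_component B \<longleftrightarrow> B = graded K"
proof -
  have "{\<Sum>i\<in>K. x i | x. \<forall>i\<in>K. x i \<in> graded {i}} = (graded K :: ('n, 'k) grassmann set)" (is "?L = _")
  proof
    show "?L \<subseteq> graded K"
      using graded_mono[of "{_}" K] by (auto intro!: grassmann.subspace_sum[OF subspace_graded])
    show "graded K \<subseteq> ?L"
    proof
      fix x :: "('n, 'k) grassmann" assume "x \<in> graded K"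
      then obtain c where c: "x = (\<Sum>S | card S \<in> K. grassmann_scale (c S) (set_mon S))"
        by (rule graded_expansion)
      have "(\<Sum>S | card S = i. grassmann_scale (c S) (set_mon S)) \<in> (graded {i} :: ('n, 'k) grassmann set)" for i
        by (intro grassmann.subspace_sum grassmann.subspace_scale subspace_graded set_mon_graded) auto
      then show "x \<in> ?L"
        unfolding c sum_graded[OF assms, symmetric] by blast
    qed
  qed
  moreover have "\<forall>i\<in>K. x i = 0"
    if x: "\<forall>i\<in>K. x i \<in> graded {i}" and zero: "(\<Sum>i\<in>K. x i) = 0" for x :: "nat \<Rightarrow> ('n, 'k) grassmann"
  proof -
    \<comment> \<open>The degree of a monomial determines the component that it comes from, so the coefficient
      families of the \<open>x i\<close> merge into the single one \<open>\<lambda>S. c (card S) S\<close>.\<close>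
    have "\<exists>c. x i = (\<Sum>S | card S = i. grassmann_scale (c S) (set_mon S))" if "i \<in> K" for i
    proof -
      obtain c where "x i = (\<Sum>S | card S \<in> {i}. grassmann_scale (c S) (set_mon S))"
        using x \<open>i \<in> K\<close> by (blast intro: graded_expansion)
      then show ?thesis by auto
    qed
    then obtain c where c: "\<And>i. i \<in> K \<Longrightarrow> x i = (\<Sum>S | card S = i. grassmann_scale (c i S) (set_mon S))"
      by metis
    then have c': "x i = (\<Sum>S | card S = i. grassmann_scale (c (card S) S) (set_mon S))" if "i \<in> K" for i
      using that by simp
    then have "(\<Sum>S | card S \<in> K. grassmann_scale (c (card S) S) (set_mon S)) = (0 :: ('n, 'k) grassmann)"
      using zero by (simp flip: sum_graded[OF assms])
    then have term_zero: "grassmann_scale (c (card S) S) (set_mon S) = (0 :: ('n, 'k) grassmann)" if "card S \<in> K" for S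
      using stable_term[OF grassmann.subspace_single_0 stable_zero, of "\<lambda>S. c (card S) S" "{S. card S \<in> K}" S] that
      by simp
    show ?thesis
    proof
      fix i assume "i \<in> K"
      then show "x i = 0"
        unfolding c'[OF \<open>i \<in> K\<close>] using term_zero
        by (intro sum.neutral ballI) (metis mem_Collect_eq)
    qed
  qed
  ultimately show ?thesis
    unfolding is_direct_sum_def grassmann_component_eq_graded by blast
qed

section \<open>Raising the degree\<close>

lemma anticommuting_cubic: "anticommuting (cubic a b c :: 'n \<Rightarrow> ('n, 'k) grassmann)"
proof (rule anticommuting_gen_update)
  have "mon [a] * mon [a] = (0 :: ('n, 'k) grassmann)"
    "mon [a] * mon [a, b, c] = (0 :: ('n, 'k) grassmann)"
    "mon [a, b, c] * mon [a] = (0 :: ('n, 'k) grassmann)"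
    "mon [a, b, c] * mon [a, b, c] = (0 :: ('n, 'k) grassmann)"
    unfolding prod_list.append[symmetric] map_append[symmetric]
    by (rule mon_not_distinct, simp)+
  then have "(mon [a] + mon [a, b, c]) * (mon [a] + mon [a, b, c]) = (0 :: ('n, 'k) grassmann)"
    by (simp only: distrib_left distrib_right add_0)
  then show "(grassmann_gen a + mon [a, b, c]) * (grassmann_gen a + mon [a, b, c]) = (0 :: ('n, 'k) grassmann)"
    by simp
next
  fix i
  have "mon [a, b, c] * mon [i] = - (mon [i] * mon [a, b, c] :: ('n, 'k) grassmann)"
    "mon [a] * mon [i] = - (mon [i] * mon [a] :: ('n, 'k) grassmann)"
    by (subst mon_mult_mon, simp)+
  then have "(mon [a] + mon [a, b, c]) * mon [i] = - (mon [i] * (mon [a] + mon [a, b, c]) :: ('n, 'k) grassmann)"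
    by (simp only: distrib_left distrib_right minus_add_distrib)
  then show "(grassmann_gen a + mon [a, b, c]) * grassmann_gen i =
      - (grassmann_gen i * (grassmann_gen a + mon [a, b, c]) :: ('n, 'k) grassmann)"
    by simp
qed

text \<open>
  Exchanging \<open>b\<close> and \<open>c\<close> changes the sign of the cubic term, and the correction of second order
  contains \<open>b\<close> twice.
\<close>

lemma cubic_inverse:
  assumes "a \<noteq> b" "a \<noteq> c"
  shows "substitute (cubic a b c) (cubic a c b i) = (grassmann_gen i :: ('n, 'k) grassmann)"
proof (cases "i = a")
  case True
  have hom: "algebra_hom (substitute (cubic a b c) :: ('n, 'k) grassmann \<Rightarrow> _)"
    by (rule algebra_hom_substitute[OF anticommuting_cubic])
  have "substitute (cubic a b c) (grassmann_gen a + grassmann_gen a * (grassmann_gen c * grassmann_gen b)) =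
      (grassmann_gen a + mon [a, b, c] +
        (grassmann_gen a + mon [a, b, c]) * (grassmann_gen c * grassmann_gen b) :: ('n, 'k) grassmann)"
    using assms by (simp only: algebra_hom_add[OF hom] algebra_hom_mult[OF hom]
        substitute_gen[OF anticommuting_cubic]) simp
  also have "\<dots> = grassmann_gen a + mon [a, b, c] + (mon [a, c, b] + mon [a, b, c, c, b])"
    by (simp add: distrib_right mult.assoc)
  also have "\<dots> = grassmann_gen a"
  proof -
    have "mon [a, b, c, c, b] = (0 :: ('n, 'k) grassmann)" by (rule mon_not_distinct) simp
    moreover have "mon [a, c, b] = (- mon [a, b, c] :: ('n, 'k) grassmann)"
      using grassmann_gen_anticommute[of c b, where 'k = 'k] by simp
    ultimately show ?thesis by (simp only: add_0_right) simp
  qed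
  finally have image: "substitute (cubic a b c)
      (grassmann_gen a + grassmann_gen a * (grassmann_gen c * grassmann_gen b)) =
      (grassmann_gen a :: ('n, 'k) grassmann)" .
  have "cubic a c b i = (grassmann_gen a + grassmann_gen a * (grassmann_gen c * grassmann_gen b)
      :: ('n, 'k) grassmann)"
    using True by simp
  then show ?thesis unfolding image by (simp only: image True)
next
  case False
  then show ?thesis using substitute_gen[OF anticommuting_cubic[of a b c], of i] by simp
qed

lemma automorphism_cubic:
  assumes "a \<noteq> b" "a \<noteq> c"
  shows "algebra_automorphism grassmann_scale (substitute (cubic a b c) :: ('n, 'k) grassmann \<Rightarrow> _)"
  using assms
  by (intro algebra_automorphism_substitute[OF anticommuting_cubic anticommuting_cubic[of a c b]] cubic_inverse)

text \<open>
  The difference between the image of \<open>e\<^sub>a x\<close> under the cubic substitution and \<open>e\<^sub>a x\<close> itself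
  is \<open>e\<^sub>a e\<^sub>b e\<^sub>c x\<close>.
\<close>

lemma stable_add_two:
  fixes B :: "('n, 'k) grassmann set"
  assumes B: "grassmann.subspace B" "Aut_stable grassmann_scale B"
    and "mon (a # js) \<in> B" "distinct (a # b # c # js)"
  shows "mon (a # b # c # js) \<in> B"
proof -
  have "map (cubic a b c) js = (map grassmann_gen js :: ('n, 'k) grassmann list)"
    using assms(4) by (intro map_cong) auto
  then have "substitute (cubic a b c) (mon (a # js)) = (mon (a # js) + mon (a # b # c # js) :: ('n, 'k) grassmann)"
    unfolding substitute_mon[OF anticommuting_cubic]
    by (simp add: distrib_right mult.assoc del: map_eq_conv)
  moreover have "substitute (cubic a b c) (mon (a # js)) \<in> B"
    using assms by (intro Aut_stableD[OF B(2) automorphism_cubic]) auto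
  ultimately show ?thesis
    using grassmann.subspace_diff[OF B(1) _ assms(3)] by (metis add_diff_cancel_left')
qed

text \<open>
  For an odd monomial \<open>x\<close>, conjugation by \<open>1 + e\<^sub>a\<close> gives \<open>x + e\<^sub>a x - x e\<^sub>a - e\<^sub>a x e\<^sub>a = x + 2 e\<^sub>a x\<close>.
\<close>

lemma stable_add_one:
  fixes B :: "('n, 'k) grassmann set"
  assumes B: "grassmann.subspace B" "Aut_stable grassmann_scale B"
    and "mon js \<in> B" "odd (length js)"
  shows "mon (a # js) \<in> B"
proof -
  let ?g = "grassmann_gen a :: ('n, 'k) grassmann"
  have inv: "(1 + ?g) * (1 - ?g) = 1" "(1 - ?g) * (1 + ?g) = 1"
    by (simp_all add: algebra_simps gen_square)
  have swap: "mon js * ?g = - (?g * mon js)"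
    using gen_mult_mon[of a js, where 'b = 'k] assms(4) by simp
  have "?g * (mon js * ?g) = 0"
    unfolding swap by (simp add: gen_square flip: mult.assoc)
  then have "(1 + ?g) * mon js * (1 - ?g) = mon js + (mon (a # js) + mon (a # js))"
    by (simp add: algebra_simps swap)
  moreover have "(1 + ?g) * mon js * (1 - ?g) \<in> B"
    using Aut_stableD[OF B(2) automorphism_conj[OF inv] assms(3)] .
  ultimately have "mon (a # js) + mon (a # js) \<in> B"
    using grassmann.subspace_diff[OF B(1) _ assms(3)] by (metis add_diff_cancel_left')
  then show ?thesis by (rule double_in_subspace[OF B(1)])
qed

text \<open>
  The degree set \<open>K\<close> consists of the degrees up to the number of generators whose component lies in
  \<open>B\<close>. By permutations, one nonzero term of degree \<open>k\<close> in an element of \<open>B\<close> puts \<open>k\<close> into \<open>K\<close>.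
\<close>

lemma stable_eq_graded:
  fixes B :: "('n::{finite,linorder}, 'k) grassmann set"
  assumes B: "grassmann.subspace B" "Aut_stable grassmann_scale B"
  obtains K where "B = graded K" "K \<subseteq> {..CARD('n)}"
    "\<And>k. k \<in> K \<Longrightarrow> 1 \<le> k \<Longrightarrow> k + 2 \<le> CARD('n) \<Longrightarrow> k + 2 \<in> K"
    "\<And>k. k \<in> K \<Longrightarrow> odd k \<Longrightarrow> k + 1 \<le> CARD('n) \<Longrightarrow> k + 1 \<in> K"
proof -
  define K where "K = {k. k \<le> CARD('n) \<and> (\<forall>S. card S = k \<longrightarrow> set_mon S \<in> B)}"
  have mon_B: "mon js \<in> B" if "length js \<in> K" "distinct js" for js
    using that by (simp add: mon_subspace_iff[OF B(1)] K_def distinct_card)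
  have K_I: "card (set js) \<in> K" if "mon js \<in> B" "distinct js" for js
  proof -
    have "set_mon (set js) \<in> B" using that mon_subspace_iff[OF B(1)] by simp
    then show ?thesis
      using stable_same_card[OF B] by (auto simp: K_def intro!: card_mono)
  qed
  have ex_list: "\<exists>js :: 'n list. distinct js \<and> length js = k" if "k \<le> CARD('n)" for k
  proof -
    obtain S :: "'n set" where "card S = k"
      using obtain_subset_with_card_n[of k "UNIV :: 'n set"] \<open>k \<le> CARD('n)\<close> by auto
    then show ?thesis
      by (intro exI[of _ "sorted_list_of_set S"]) simp
  qed
  show thesis
  proof (rule that)
    show "B = graded K"
    proof
      show "graded K \<subseteq> B"
        unfolding graded_def by (rule grassmann.span_minimal) (auto simp: K_def B)
      show "B \<subseteq> graded K"
      proof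
        fix x assume "x \<in> B"
        obtain c where c: "x = (\<Sum>S | card S \<in> UNIV. grassmann_scale (c S) (set_mon S))"
          by (rule graded_expansion[of x UNIV]) (simp_all add: graded_UNIV)
        have "grassmann_scale (c S) (set_mon S) \<in> graded K" for S
        proof (cases "c S = 0")
          case True
          then show ?thesis by (simp add: grassmann.subspace_0 subspace_graded)
        next
          case False
          have "grassmann_scale (c S) (set_mon S) \<in> B"
            using \<open>x \<in> B\<close> unfolding c by (rule stable_term[OF B]) simp
          then have "grassmann_scale (inverse (c S)) (grassmann_scale (c S) (set_mon S)) \<in> B"
            by (rule grassmann.subspace_scale[OF B(1)])
          then have "set_mon S \<in> B" using False by simp
          then have "card S \<in> K"
            using stable_same_card[OF B] by (auto simp: K_def intro!: card_mono)
          then show ?thesis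
            by (intro grassmann.subspace_scale subspace_graded set_mon_graded) simp_all
        qed
        then show "x \<in> graded K"
          unfolding c by (intro grassmann.subspace_sum subspace_graded)
      qed
    qed
    show "K \<subseteq> {..CARD('n)}" by (auto simp: K_def)
    show "k + 2 \<in> K" if k: "k \<in> K" "1 \<le> k" "k + 2 \<le> CARD('n)" for k
    proof -
      \<comment> \<open>The degree \<open>k\<close> monomial keeps \<open>a\<close>, since \<open>a\<close> is the generator that gets substituted;
        this is where \<open>k\<close> has to be positive.\<close>
      obtain js :: "'n list" where js: "distinct js" "length js = k + 2"
        using ex_list[OF k(3)] by blast
      then obtain a b c us where us: "js = a # b # c # us"
        using k(2) by (cases js; cases "tl js"; cases "tl (tl js)") auto
      have "mon (a # us) \<in> B" using js us k(1) by (intro mon_B) auto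
      then have "mon js \<in> B" unfolding us using js us by (intro stable_add_two[OF B]) auto
      then show ?thesis using K_I[OF _ js(1)] js by (simp add: distinct_card)
    qed
    show "k + 1 \<in> K" if k: "k \<in> K" "odd k" "k + 1 \<le> CARD('n)" for k
    proof -
      obtain js :: "'n list" where js: "distinct js" "length js = k + 1"
        using ex_list[OF k(3)] by blast
      then obtain a us where us: "js = a # us" by (cases js) auto
      have "mon us \<in> B" using js us k(1) by (intro mon_B) auto
      then have "mon js \<in> B" unfolding us using js us k(2) by (intro stable_add_one[OF B]) auto
      then show ?thesis using K_I[OF _ js(1)] js by (simp add: distinct_card)
    qed
  qed
qed

section \<open>Stability of the subspaces in the classification\<close>

text \<open>
  The constant term of \<open>\<sigma> e\<^sub>i\<close> squares to zero because \<open>\<sigma> e\<^sub>i\<close> does, and in a field it is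
  therefore zero.
\<close>

lemma hom_gen_graded:
  fixes \<sigma> :: "('n::linorder, 'k) grassmann \<Rightarrow> _"
  assumes \<sigma>: "algebra_hom \<sigma>"
  shows "\<sigma> (grassmann_gen i) \<in> graded {1..}"
proof -
  \<comment> \<open>The augmentation, which kills all positive degrees and fixes the scalars.\<close>
  define \<epsilon> where "\<epsilon> = (substitute (\<lambda>_. 0) :: ('n, 'k) grassmann \<Rightarrow> _)"
  have anti: "anticommuting (\<lambda>_. 0 :: ('n, 'k) grassmann)" by (simp add: anticommuting_def)
  have \<epsilon>: "algebra_hom \<epsilon>" unfolding \<epsilon>_def by (rule algebra_hom_substitute[OF anti])
  have \<epsilon>_zero: "\<epsilon> z = 0" if "z \<in> graded {1..}" for z
    using that unfolding graded_def
  proof (induction rule: grassmann.span_induct_alt)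
    case base
    then show ?case by (rule algebra_hom_zero[OF \<epsilon>])
  next
    case (step c s y)
    then obtain S where S: "s = set_mon S" "card S \<ge> 1" by auto
    then obtain j js where "sorted_list_of_set S = j # js"
      by (cases "sorted_list_of_set S") (auto simp flip: length_sorted_list_of_set)
    then have "\<epsilon> s = 0"
      by (simp add: S set_mon_def algebra_hom_mult[OF \<epsilon>]) (simp add: \<epsilon>_def substitute_gen[OF anti])
    then show ?case using step by (simp add: algebra_hom_add[OF \<epsilon>] algebra_hom_scale[OF \<epsilon>])
  qed
  have "{0} \<union> {1..} = (UNIV :: nat set)" by auto
  then have "\<sigma> (grassmann_gen i) \<in> graded {0} + graded {1..}"
    by (simp add: graded_UNIV flip: graded_Un)
  then obtain c z where cz: "\<sigma> (grassmann_gen i) = grassmann_scale c 1 + z" "z \<in> graded {1..}"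
    by (auto simp: set_plus_def grassmann_scalars_def simp flip: grassmann_scalars_eq_graded)
  then have "\<epsilon> (\<sigma> (grassmann_gen i)) = grassmann_scale c 1"
    by (simp add: algebra_hom_add[OF \<epsilon>] algebra_hom_scale[OF \<epsilon>] algebra_hom_one[OF \<epsilon>] \<epsilon>_zero)
  moreover have "\<epsilon> (\<sigma> (grassmann_gen i)) * \<epsilon> (\<sigma> (grassmann_gen i)) = 0"
    by (simp add: gen_square algebra_hom_zero[OF \<epsilon>] algebra_hom_zero[OF \<sigma>]
        flip: algebra_hom_mult[OF \<epsilon>] algebra_hom_mult[OF \<sigma>])
  ultimately have "c = 0"
    by (simp flip: grassmann_scale_mult_left)
  then show ?thesis using cz by simp
qed

lemma hom_mon_graded:
  fixes \<sigma> :: "('n::linorder, 'k) grassmann \<Rightarrow> _"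
  assumes \<sigma>: "algebra_hom \<sigma>"
  shows "\<sigma> (mon js) \<in> graded {length js..}"
proof (induction js)
  case Nil
  then show ?case by (simp add: graded_UNIV atLeast_0)
next
  case (Cons i js)
  have "\<sigma> (grassmann_gen i) * \<sigma> (mon js) \<in> graded {length (i # js)..}"
    by (rule graded_mult[OF hom_gen_graded[OF \<sigma>] Cons]) auto
  then show ?case by (simp add: algebra_hom_mult[OF \<sigma>])
qed

text \<open>
  \<open>2 e\<^sub>i e\<^sub>j\<close> is the commutator of \<open>e\<^sub>i\<close> and \<open>e\<^sub>j\<close>. A single \<open>\<sigma> e\<^sub>i\<close> may have even
  components, and it is the commutator that removes the odd part of the product.
\<close>

lemma hom_pair_graded:
  fixes \<sigma> :: "('n::linorder, 'k) grassmann \<Rightarrow> _"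
  assumes \<sigma>: "algebra_hom \<sigma>"
  shows "\<sigma> (grassmann_gen i * grassmann_gen j) \<in> graded {k. 2 \<le> k \<and> even k}"
proof (rule double_in_subspace[OF subspace_graded])
  have "grassmann_gen i * grassmann_gen j + grassmann_gen i * grassmann_gen j =
      (grassmann_gen i * grassmann_gen j - grassmann_gen j * grassmann_gen i :: ('n, 'k) grassmann)"
    using grassmann_gen_anticommute[of j i, where 'k = 'k] by simp
  then have "\<sigma> (grassmann_gen i * grassmann_gen j) + \<sigma> (grassmann_gen i * grassmann_gen j) =
      \<sigma> (grassmann_gen i) * \<sigma> (grassmann_gen j) - \<sigma> (grassmann_gen j) * \<sigma> (grassmann_gen i)"
    by (metis algebra_hom_add[OF \<sigma>] algebra_hom_diff[OF \<sigma>] algebra_hom_mult[OF \<sigma>])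
  then show "\<sigma> (grassmann_gen i * grassmann_gen j) + \<sigma> (grassmann_gen i * grassmann_gen j)
      \<in> graded {k. 2 \<le> k \<and> even k}"
    using commutator_graded[OF hom_gen_graded[OF \<sigma>] hom_gen_graded[OF \<sigma>]] by simp
qed

text \<open>
  A word of even length is a product of pairs.
\<close>

lemma hom_even_mon_graded:
  fixes \<sigma> :: "('n::linorder, 'k) grassmann \<Rightarrow> _"
  assumes \<sigma>: "algebra_hom \<sigma>" and "even (length js)"
  shows "\<sigma> (mon js) \<in> graded {k. length js \<le> k \<and> even k}"
  using assms(2)
proof (induction js rule: induct_list012)
  case 1
  have "mon [] \<in> (graded {k. even k} :: ('n, 'k) grassmann set)" by (rule mon_graded) simp
  then show ?case by (simp add: algebra_hom_one[OF \<sigma>])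
next
  case (3 i j js)
  have "\<sigma> (grassmann_gen i * grassmann_gen j) * \<sigma> (mon js)
      \<in> graded {k. length (i # j # js) \<le> k \<and> even k}"
    by (rule graded_mult[OF hom_pair_graded[OF \<sigma>] "3.IH"(1)]) (use "3.prems" in auto)
  then show ?case by (simp add: algebra_hom_mult[OF \<sigma>] mult.assoc)
qed simp

lemma stable_graded_atLeast:
  "Aut_stable grassmann_scale (graded {j..} :: ('n::linorder, 'k) grassmann set)"
proof (rule stable_gradedI)
  fix \<sigma> :: "('n, 'k) grassmann \<Rightarrow> _" and js :: "'n list"
  assume "algebra_hom \<sigma>" "length js \<in> {j..}"
  then show "\<sigma> (mon js) \<in> graded {j..}"
    using hom_mon_graded[of \<sigma> js] graded_mono[of "{length js..}" "{j..}"] by auto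
qed

lemma stable_graded_even:
  "Aut_stable grassmann_scale (graded {k. j \<le> k \<and> even k} :: ('n::linorder, 'k) grassmann set)"
proof (rule stable_gradedI)
  fix \<sigma> :: "('n, 'k) grassmann \<Rightarrow> _" and js :: "'n list"
  assume \<sigma>: "algebra_hom \<sigma>" and js: "length js \<in> {k. j \<le> k \<and> even k}"
  then have "\<sigma> (mon js) \<in> graded {k. length js \<le> k \<and> even k}"
    by (intro hom_even_mon_graded) auto
  moreover have "{k. length js \<le> k \<and> even k} \<subseteq> {k. j \<le> k \<and> even k}" using js by auto
  ultimately show "\<sigma> (mon js) \<in> graded {k. j \<le> k \<and> even k}" using graded_mono by blast
qed

lemma form_a_iff:
  fixes B :: "('n::{finite,linorder}, 'k) grassmann set"
  shows "form_a B \<longleftrightarrow> (\<exists>j. even j \<and> 0 < j \<and> j \<le> CARD('n) \<and> B = graded {k. j \<le> k \<and> even k})"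
proof -
  have "{k. j \<le> k \<and> k \<le> CARD('n) \<and> even k} = {k. j \<le> k \<and> even k} \<inter> {..CARD('n)}" for j by auto
  then show ?thesis
    unfolding form_a_def by (simp add: direct_sum_components_iff graded_restrict)
qed

lemma form_b_iff:
  fixes B :: "('n::{finite,linorder}, 'k) grassmann set"
  shows "form_b B \<longleftrightarrow> (\<exists>j. 1 \<le> j \<and> j \<le> CARD('n) \<and> B = graded {j..})"
proof -
  have "{j..CARD('n)} = {j..} \<inter> {..CARD('n)}" for j by auto
  then show ?thesis
    unfolding form_b_def by (simp add: direct_sum_components_iff graded_restrict)
qed

lemma stable_if_form:
  fixes B :: "('n::{finite,linorder}, 'k) grassmann set"
  assumes "form_a B \<or> form_b B \<or> form_c B \<or> form_d B"
  shows "Aut_stable grassmann_scale B"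
proof -
  have a: "Aut_stable grassmann_scale B" if "form_a B" for B :: "('n, 'k) grassmann set"
    using that stable_graded_even by (auto simp: form_a_iff)
  have b: "Aut_stable grassmann_scale B" if "form_b B" for B :: "('n, 'k) grassmann set"
    using that stable_graded_atLeast by (auto simp: form_b_iff)
  have c: "Aut_stable grassmann_scale B" if "form_c B" for B :: "('n, 'k) grassmann set"
    using that a b stable_plus by (auto simp: form_c_def)
  have d: "Aut_stable grassmann_scale B" if "form_d B" for B :: "('n, 'k) grassmann set"
    using that a b c stable_plus stable_scalars stable_zero unfolding form_d_def by metis
  show ?thesis using assms a b c d by blast
qed

end

section \<open>The classification\<close>

text \<open>
  The set is determined by its least even and its least odd element. From the least odd element
  onwards every degree occurs, since the step \<open>k \<mapsto> k + 1\<close> reaches the even ones.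
\<close>

lemma degree_set_cases:
  fixes K :: "nat set"
  assumes K: "K \<subseteq> {1..n}" "K \<noteq> {}"
    and two: "\<And>k. k \<in> K \<Longrightarrow> k + 2 \<le> n \<Longrightarrow> k + 2 \<in> K"
    and one: "\<And>k. k \<in> K \<Longrightarrow> odd k \<Longrightarrow> k + 1 \<le> n \<Longrightarrow> k + 1 \<in> K"
  shows "(\<exists>j. even j \<and> 0 < j \<and> j \<le> n \<and> K = {k. j \<le> k \<and> even k} \<inter> {..n}) \<or>
    (\<exists>j. 1 \<le> j \<and> j \<le> n \<and> K = {j..} \<inter> {..n}) \<or>
    (\<exists>i j. even i \<and> 0 < i \<and> i \<le> n \<and> 1 \<le> j \<and> j \<le> n \<and>
      K = ({k. i \<le> k \<and> even k} \<union> {j..}) \<inter> {..n})"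
    (is "?evens \<or> ?tail \<or> ?mixed")
proof -
  have up: "k + 2 * m \<le> n \<Longrightarrow> k + 2 * m \<in> K" if "k \<in> K" for k m
    using that two[of "k + 2 * _"] by (induction m) auto
  have up': "m \<in> K" if "k \<in> K" "k \<le> m" "m \<le> n" "even k \<longleftrightarrow> even m" for k m
  proof -
    have "even (m - k)" using that by simp
    then obtain d where "m - k = 2 * d" by (elim evenE)
    then have "m = k + 2 * d" using \<open>k \<le> m\<close> by linarith
    then show ?thesis using up[of k d] that by simp
  qed
  define e where "e = (LEAST k. k \<in> K \<and> even k)"
  define o' where "o' = (LEAST k. k \<in> K \<and> odd k)"
  have e: "e \<in> K" "even e" "\<And>k. k \<in> K \<Longrightarrow> even k \<Longrightarrow> e \<le> k" if "\<exists>k\<in>K. even k"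
    unfolding e_def using that LeastI_ex[of "\<lambda>k. k \<in> K \<and> even k"]
    by (auto intro: Least_le)
  have o': "o' \<in> K" "odd o'" "\<And>k. k \<in> K \<Longrightarrow> odd k \<Longrightarrow> o' \<le> k" if "\<exists>k\<in>K. odd k"
    unfolding o'_def using that LeastI_ex[of "\<lambda>k. k \<in> K \<and> odd k"]
    by (auto intro: Least_le)
  show ?thesis
  proof (cases "\<exists>k\<in>K. odd k")
    case False
    then have ex: "\<exists>k\<in>K. even k" using K(2) by blast
    have "K = {k. e \<le> k \<and> even k} \<inter> {..n}"
    proof (intro equalityI subsetI)
      fix k assume "k \<in> K"
      then show "k \<in> {k. e \<le> k \<and> even k} \<inter> {..n}" using e(3)[OF ex] False K(1) by auto
    next
      fix k assume "k \<in> {k. e \<le> k \<and> even k} \<inter> {..n}"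
      then show "k \<in> K" using e[OF ex] up'[of e k] by auto
    qed
    moreover have "0 < e" "e \<le> n" using e(1)[OF ex] K(1) by auto
    ultimately have ?evens using e(2)[OF ex] by blast
    then show ?thesis by simp
  next
    case True
    have above: "m \<in> K" if "o' \<le> m" "m \<le> n" for m
    proof (cases "odd m")
      case True
      then show ?thesis using up'[of o' m] o'[OF \<open>\<exists>k\<in>K. odd k\<close>] that by simp
    next
      case False
      then have "o' + 1 \<le> m" using o'(2)[OF True] that by (cases "o' = m") auto
      moreover have "o' + 1 \<in> K" using calculation that o'[OF True] by (intro one) auto
      ultimately show ?thesis using up'[of "o' + 1" m] o'[OF True] that False by simp
    qed
    have bounds: "1 \<le> o'" "o' \<le> n" using o'(1)[OF True] K(1) by auto
    show ?thesis
    proof (cases "\<exists>k\<in>K. even k")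
      case False
      have "K = {o'..} \<inter> {..n}" using above o'(3)[OF True] False K(1) by fastforce
      then have ?tail using bounds by blast
      then show ?thesis by simp
    next
      case ex: True
      have "K = ({k. e \<le> k \<and> even k} \<union> {o'..}) \<inter> {..n}"
      proof (intro equalityI subsetI)
        fix k assume "k \<in> K"
        then show "k \<in> ({k. e \<le> k \<and> even k} \<union> {o'..}) \<inter> {..n}"
          using e(3)[OF ex] o'(3)[OF True] K(1) by (cases "even k") auto
      next
        fix k assume "k \<in> ({k. e \<le> k \<and> even k} \<union> {o'..}) \<inter> {..n}"
        then show "k \<in> K" using e[OF ex] above up'[of e k] by auto
      qed
      moreover have "0 < e" "e \<le> n" using e(1)[OF ex] K(1) by auto
      ultimately have ?mixed using bounds e(2)[OF ex] by blast
      then show ?thesis by simp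
    qed
  qed
qed

theorem theorem0p3:
  fixes B :: "('n::{finite,linorder}, 'k::field) grassmann set"
  assumes "CHAR('k) \<noteq> 2"
    and "grassmann.subspace B"
    and "B \<noteq> {0}"
  shows "Aut_stable grassmann_scale B \<longleftrightarrow> form_a B \<or> form_b B \<or> form_c B \<or> form_d B"
proof
  have two: "(2 :: 'k) \<noteq> 0"
  proof
    assume "(2 :: 'k) = 0"
    then have "CHAR('k) dvd 2"
      using of_nat_eq_0_iff_char_dvd[of 2, where 'a = 'k] by simp
    then show False
      using assms(1) CHAR_not_1[where 'a = 'k] by (auto simp: prime_nat_iff dest: two_is_prime_nat[unfolded prime_nat_iff, THEN conjunct2, rule_format])
  qed
  show "Aut_stable grassmann_scale B" if "form_a B \<or> form_b B \<or> form_c B \<or> form_d B"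
    by (rule stable_if_form[OF two that])
  assume "Aut_stable grassmann_scale B"
  then obtain K where K: "B = graded K" "K \<subseteq> {..CARD('n)}"
    "\<And>k. k \<in> K \<Longrightarrow> 1 \<le> k \<Longrightarrow> k + 2 \<le> CARD('n) \<Longrightarrow> k + 2 \<in> K"
    "\<And>k. k \<in> K \<Longrightarrow> odd k \<Longrightarrow> k + 1 \<le> CARD('n) \<Longrightarrow> k + 1 \<in> K"
    using stable_eq_graded[OF two assms(2)] by metis
  define B' where "B' = (graded (K - {0}) :: ('n, 'k) grassmann set)"
  have B': "B' = {0} \<or> form_a B' \<or> form_b B' \<or> form_c B'"
  proof (cases "K - {0} = {}")
    case True
    then show ?thesis unfolding B'_def by (simp only: graded_empty simp_thms)
  next
    case False
    have bounds: "K - {0} \<subseteq> {1..CARD('n)}"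
      using K(2) by (auto simp: Suc_le_eq)
    have two_up: "k + 2 \<in> K - {0}" if "k \<in> K - {0}" "k + 2 \<le> CARD('n)" for k
      using K(3)[of k] that by auto
    have one_up: "k + 1 \<in> K - {0}" if "k \<in> K - {0}" "odd k" "k + 1 \<le> CARD('n)" for k
      using K(4)[of k] that by auto
    have "K - {0} \<noteq> {}" by (rule False)
    note degree_set_cases[OF bounds this two_up one_up]
    then consider
      (evens) j where "even j" "0 < j" "j \<le> CARD('n)" "K - {0} = {k. j \<le> k \<and> even k} \<inter> {..CARD('n)}"
      | (tail) j where "1 \<le> j" "j \<le> CARD('n)" "K - {0} = {j..} \<inter> {..CARD('n)}"
      | (mixed) i j where "even i" "0 < i" "i \<le> CARD('n)" "1 \<le> j" "j \<le> CARD('n)"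
          "K - {0} = ({k. i \<le> k \<and> even k} \<union> {j..}) \<inter> {..CARD('n)}"
      by blast
    then show ?thesis
    proof cases
      case (evens j)
      have "B' = graded {k. j \<le> k \<and> even k}"
        unfolding B'_def evens(4) by (rule graded_restrict)
      then show ?thesis
        unfolding form_a_iff[OF two] using evens(1-3) by blast
    next
      case (tail j)
      have "B' = graded {j..}"
        unfolding B'_def tail(3) by (rule graded_restrict)
      then show ?thesis
        unfolding form_b_iff[OF two] using tail(1,2) by blast
    next
      case (mixed i j)
      have "B' = graded {k. i \<le> k \<and> even k} + graded {j..}"
        unfolding B'_def mixed(6) graded_restrict by (rule graded_Un)
      then show ?thesis
        unfolding form_c_def form_a_iff[OF two] form_b_iff[OF two] using mixed(1-5) by blast
    qed
  qed
  show "form_a B \<or> form_b B \<or> form_c B \<or> form_d B"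
  proof (cases "0 \<in> K")
    case True
    then have "B = grassmann_scalars + B'"
      unfolding B'_def grassmann_scalars_eq_graded K(1) graded_Un[symmetric]
      by (simp add: insert_absorb)
    then show ?thesis using B' unfolding form_d_def by blast
  next
    case False
    then have "B = B'" by (simp add: B'_def K(1))
    then show ?thesis using B' assms(3) by blast
  qed
qed

end
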